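(* Let $G$ be a finite group, let $\sigma_i,\tau_i\in G$, $1\le i\le6$, be distinct elements, let $\mathcal{O}$ be a conjugacy class of $G$, and let $(\rho,V)$ be an irreducible complex representation of the centralizer $G^{\sigma_1}$. Suppose that (H1) $(\sigma,\tau)$ is of type $\mathfrak{O}^{(2)}$; (H2) all $\sigma_i$ and $\tau_i$ lie in $\mathcal{O}$, and $g\in G$ is an element such that $g\sigma_1g^{-1}=\tau_1$; (H3) $q_{\sigma_1\sigma_1}=-1$; there exists $v\in V\setminus\{0\}$ such that (H4) $\rho(\sigma_6)v=-v$ and (H5) $\rho(\tau_1)v=-v$; and there exists $w\in V\setminus\{0\}$ such that (H6) $\rho(g^{-1}\sigma_1g)w=-w$ and (H7) $\rho(g^{-1}\sigma_6g)w=-w$. Then $\dim\mathfrak{B}(\mathcal{O},\rho)=\infty$.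
   Context: The base field is $\mathbb{C}$. For $x,y\in G$ write $x\triangleright y=xyx^{-1}$; $G^s$ is the centralizer of $s$ in $G$. The octahedral rack is $X=\{1,\dots,6\}$ with operation $i\triangleright j$ given by the permutations $\phi_i(j)=i\triangleright j$: $\phi_1=(2\,5\,4\,3)$, $\phi_2=(1\,3\,6\,5)$, $\phi_3=(1\,4\,6\,2)$, $\phi_4=(1\,5\,6\,3)$, $\phi_5=(1\,2\,6\,4)$, $\phi_6=(2\,3\,4\,5)$ (cycle notation; e.g. $1\triangleright2=5$, $1\triangleright5=4$, $1\triangleright4=3$, $1\triangleright3=2$, $1\triangleright1=1$, $1\triangleright6=6$). In subindices $\triangleright$ means this operation. A family $(\sigma_i)_{1\le i\le6}$ of distinct elements of $G$ is of type $\mathfrak{O}$ if $\sigma_i\triangleright\sigma_j=\sigma_{i\triangleright j}$ for $1\le i,j\le6$. For $\sigma_i,\tau_i$ ($1\le i\le6$) all distinct, $(\sigma,\tau)$ is of type $\mathfrak{O}^{(2)}$ if $(\sigma_i)$ and $(\tau_i)$ are both of type $\mathfrak{O}$ and $\sigma_i\triangleright\tau_j=\tau_{i\triangleright j}$, $\tau_i\triangleright\sigma_j=\sigma_{i\triangleright j}$ for $1\le i,j\le6$. Yetter-Drinfeld module $M(\mathcal{O},\rho)$: let $s\in\mathcal{O}$ (here $s=\sigma_1$) and let $(\rho,V)$ be an irreducible complex representation of $G^s$. Enumerate $\mathcal{O}=\{t_1=s,\dots,t_M\}$ and choose $g_i\in G$ with $g_i\triangleright s=t_i$. Then $M(\mathcal{O},\rho)=\bigoplus_{1\le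 i\le M}g_i\otimes V$, with $g_iv:=g_i\otimes v$, is a braided vector space with braiding $c(g_iv\otimes g_jw)=g_h(\rho(\gamma)w)\otimes g_iv$, where $t_ig_j=g_h\gamma$ with unique $h$ and $\gamma\in G^s$. Up to isomorphism it does not depend on the choices. Since $s$ is central in $G^s$, $\rho(s)$ is a scalar, denoted $q_{ss}$. Nichols algebra: for a braided vector space $(U,c)$, $\mathfrak{B}(U)=T(U)/\bigoplus_{n\ge2}\ker\mathfrak{S}_n$, where $\mathfrak{S}_n=\sum_{\pi\in\mathbb{S}_n}c_\pi$ acts on $U^{\otimes n}$, with $c_\pi=c_{i_1}\cdots c_{i_r}$ for a reduced expression $\pi=s_{i_1}\cdots s_{i_r}$ in simple transpositions, and $c_i$ is $c$ applied to the tensor factors $i,i+1$. Write $\mathfrak{B}(\mathcal{O},\rho)=\mathfrak{B}(M(\mathcal{O},\rho))$. *)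

theory Defs
  imports
    Complex_Main
    "HOL-Library.Poly_Mapping"
    "HOL-Library.Extended_Nat"
    "HOL-Combinatorics.Combinatorics"
    "HOL-Algebra.QuotRing"
begin

section \<open>The octahedral rack and families of type O and O\<open>^(2)\<close>\<close>

definition oct_perm :: "nat \<Rightarrow> nat \<Rightarrow> nat" where
  "oct_perm i =
    (if i = 1 then cycle_of_list [2, 5, 4, 3]
     else if i = 2 then cycle_of_list [1, 3, 6, 5]
     else if i = 3 then cycle_of_list [1, 4, 6, 2]
     else if i = 4 then cycle_of_list [1, 5, 6, 3]
     else if i = 5 then cycle_of_list [1, 2, 6, 4]
     else if i = 6 then cycle_of_list [2, 3, 4, 5]
     else id)"

text \<open>The cycle \<open>(a b c d)\<close> sends \<open>a\<close> to \<open>b\<close>:\<close>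

lemma oct_perm_1:
  "oct_perm 1 1 = 1" "oct_perm 1 2 = 5" "oct_perm 1 5 = 4"
  "oct_perm 1 4 = 3" "oct_perm 1 3 = 2" "oct_perm 1 6 = 6"
  by (simp_all add: oct_perm_def)

definition conj_by :: "('g, 'm) monoid_scheme \<Rightarrow> 'g \<Rightarrow> 'g \<Rightarrow> 'g" where
  "conj_by G x y = x \<otimes>\<^bsub>G\<^esub> y \<otimes>\<^bsub>G\<^esub> inv\<^bsub>G\<^esub> x"

definition conjugacy_classes :: "('g, 'm) monoid_scheme \<Rightarrow> 'g set set" where
  "conjugacy_classes G = (\<lambda>s. (\<lambda>x. conj_by G x s) ` carrier G) ` carrier G"

definition centralizer :: "('g, 'm) monoid_scheme \<Rightarrow> 'g \<Rightarrow> 'g set" where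
  "centralizer G s = {x \<in> carrier G. x \<otimes>\<^bsub>G\<^esub> s = s \<otimes>\<^bsub>G\<^esub> x}"

text \<open>Families \<open>(\<sigma>\<^sub>i)\<close> with \<open>1 \<le> i \<le> 6\<close> are functions on \<^typ>\<open>nat\<close>; only the values on \<open>{1..6}\<close>
  matter.\<close>

definition type_O :: "('g, 'm) monoid_scheme \<Rightarrow> (nat \<Rightarrow> 'g) \<Rightarrow> bool" where
  "type_O G \<sigma> \<longleftrightarrow>
     \<sigma> ` {1..6} \<subseteq> carrier G \<and> inj_on \<sigma> {1..6} \<and>
     (\<forall>i\<in>{1..6}. \<forall>j\<in>{1..6}. conj_by G (\<sigma> i) (\<sigma> j) = \<sigma> (oct_perm i j))"

definition type_O2 :: "('g, 'm) monoid_scheme \<Rightarrow> (nat \<Rightarrow> 'g) \<Rightarrow> (nat \<Rightarrow> 'g) \<Rightarrow> bool" where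
  "type_O2 G \<sigma> \<tau> \<longleftrightarrow>
     type_O G \<sigma> \<and> type_O G \<tau> \<and> \<sigma> ` {1..6} \<inter> \<tau> ` {1..6} = {} \<and>
     (\<forall>i\<in>{1..6}. \<forall>j\<in>{1..6}.
        conj_by G (\<sigma> i) (\<tau> j) = \<tau> (oct_perm i j) \<and>
        conj_by G (\<tau> i) (\<sigma> j) = \<sigma> (oct_perm i j))"


section \<open>Irreducible complex representations\<close>

text \<open>The representation space is the whole type \<^typ>\<open>'v\<close>, with scalar multiplication \<open>scale\<close>.
  The representation need only be specified on the carrier of \<open>H\<close>.\<close>

definition representation_of ::
    "('g, 'm) monoid_scheme \<Rightarrow> (complex \<Rightarrow> 'v::ab_group_add \<Rightarrow> 'v) \<Rightarrow> ('g \<Rightarrow> 'v \<Rightarrow> 'v) \<Rightarrow> bool" where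
  "representation_of H scale \<rho> \<longleftrightarrow>
     vector_space scale \<and>
     (\<forall>h\<in>carrier H. Vector_Spaces.linear scale scale (\<rho> h)) \<and>
     \<rho> \<one>\<^bsub>H\<^esub> = id \<and>
     (\<forall>h\<in>carrier H. \<forall>k\<in>carrier H. \<rho> (h \<otimes>\<^bsub>H\<^esub> k) = \<rho> h \<circ> \<rho> k)"

definition irreducible_representation_of ::
    "('g, 'm) monoid_scheme \<Rightarrow> (complex \<Rightarrow> 'v::ab_group_add \<Rightarrow> 'v) \<Rightarrow> ('g \<Rightarrow> 'v \<Rightarrow> 'v) \<Rightarrow> bool" where
  "irreducible_representation_of H scale \<rho> \<longleftrightarrow>
     representation_of H scale \<rho> \<and>
     (UNIV :: 'v set) \<noteq> {0} \<and>
     (\<forall>W. module.subspace scale W \<and> (\<forall>h\<in>carrier H. \<rho> h ` W \<subseteq> W) \<longrightarrow> W = {0} \<or> W = UNIV)"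

definition scalar_of :: "(complex \<Rightarrow> 'v::ab_group_add \<Rightarrow> 'v) \<Rightarrow> ('v \<Rightarrow> 'v) \<Rightarrow> complex" where
  "scalar_of scale f = (THE q. \<forall>v. f v = scale q v)"


section \<open>Nichols algebras\<close>

text \<open>A complex vector space \<open>U\<close> is given by a basis \<open>E\<close>. The words of length \<open>n\<close> over \<open>E\<close> are then a
  basis of the \<open>n\<close>-th tensor power of \<open>U\<close> (the word \<open>[e\<^sub>1, ..., e\<^sub>n]\<close> stands for the tensor
  \<open>e\<^sub>1 \<otimes> ... \<otimes> e\<^sub>n\<close>), and the tensor algebra \<open>T(U)\<close> is the space of finitely supported functions on
  words, with the bilinear extension of concatenation as product. A braiding \<open>c\<close> on \<open>U\<close> is given by
  the elements \<open>c a b\<close> of the second tensor power that are the images of \<open>a \<otimes> b\<close>, for \<open>a, b\<close> in \<open>E\<close>.\<close>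

type_synonym 'e tensor = "'e list \<Rightarrow>\<^sub>0 complex"

definition tscale :: "complex \<Rightarrow> ('a \<Rightarrow>\<^sub>0 complex) \<Rightarrow> ('a \<Rightarrow>\<^sub>0 complex)" where
  "tscale a p = Poly_Mapping.map ((*) a) p"

lemma lookup_tscale: "Poly_Mapping.lookup (tscale a p) w = a * Poly_Mapping.lookup p w"
  by (simp add: tscale_def map.rep_eq when_def)

lemma vector_space_tscale: "vector_space tscale"
  by unfold_locales
    (auto intro!: poly_mapping_eqI simp: lookup_tscale lookup_add algebra_simps)

definition linear_extension :: "('e list \<Rightarrow> 'e tensor) \<Rightarrow> 'e tensor \<Rightarrow> 'e tensor" where
  "linear_extension f p = (\<Sum>w\<in>Poly_Mapping.keys p. tscale (Poly_Mapping.lookup p w) (f w))"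

definition tensor_mult :: "'e tensor \<Rightarrow> 'e tensor \<Rightarrow> 'e tensor" where
  "tensor_mult p q =
     (\<Sum>u\<in>Poly_Mapping.keys p. \<Sum>v\<in>Poly_Mapping.keys q.
        Poly_Mapping.single (u @ v) (Poly_Mapping.lookup p u * Poly_Mapping.lookup q v))"

definition tensor_algebra :: "'e set \<Rightarrow> 'e tensor ring" where
  "tensor_algebra E =
     \<lparr>carrier = {p. Poly_Mapping.keys p \<subseteq> lists E}, mult = tensor_mult, one = Poly_Mapping.single [] 1,
      zero = 0, add = (+)\<rparr>"

definition tensor_power :: "'e set \<Rightarrow> nat \<Rightarrow> 'e tensor set" where
  "tensor_power E n = {p. Poly_Mapping.keys p \<subseteq> {w \<in> lists E. length w = n}}"

text \<open>The braiding \<open>c\<close> applied to the adjacent tensor factors at positions \<open>i\<close> and \<open>i + 1\<close>, counted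
  from 0.\<close>

definition braid_at :: "('e \<Rightarrow> 'e \<Rightarrow> 'e tensor) \<Rightarrow> nat \<Rightarrow> 'e tensor \<Rightarrow> 'e tensor" where
  "braid_at c i = linear_extension (\<lambda>w.
     tensor_mult (Poly_Mapping.single (take i w) 1)
       (tensor_mult (c (w ! i) (w ! Suc i)) (Poly_Mapping.single (drop (i + 2) w) 1)))"

text \<open>A word \<open>[i\<^sub>1, ..., i\<^sub>r]\<close> of minimal length such that \<open>\<pi>\<close> is the product of the transpositions
  \<open>(i\<^sub>k, i\<^sub>k + 1)\<close> of \<open>{..<n}\<close>. If \<open>c\<close> satisfies the braid equation, the choice of the word does not
  affect \<open>braid_perm\<close>.\<close>

definition reduced_word :: "nat \<Rightarrow> (nat \<Rightarrow> nat) \<Rightarrow> nat list" where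
  "reduced_word n \<pi> =
     (ARG_MIN length is. (\<forall>i\<in>set is. Suc i < n) \<and> apply_adj_transps is = \<pi>)"

definition braid_perm ::
    "('e \<Rightarrow> 'e \<Rightarrow> 'e tensor) \<Rightarrow> nat \<Rightarrow> (nat \<Rightarrow> nat) \<Rightarrow> 'e tensor \<Rightarrow> 'e tensor" where
  "braid_perm c n \<pi> = foldr (\<circ>) (map (braid_at c) (reduced_word n \<pi>)) id"

definition quantum_symmetrizer ::
    "('e \<Rightarrow> 'e \<Rightarrow> 'e tensor) \<Rightarrow> nat \<Rightarrow> 'e tensor \<Rightarrow> 'e tensor" where
  "quantum_symmetrizer c n p = (\<Sum>\<pi> | \<pi> permutes {..<n}. braid_perm c n \<pi> p)"

definition nichols_ideal :: "'e set \<Rightarrow> ('e \<Rightarrow> 'e \<Rightarrow> 'e tensor) \<Rightarrow> 'e tensor set" where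
  "nichols_ideal E c =
     module.span tscale (\<Union>n\<in>{2..}. {p \<in> tensor_power E n. quantum_symmetrizer c n p = 0})"

definition nichols_algebra :: "'e set \<Rightarrow> ('e \<Rightarrow> 'e \<Rightarrow> 'e tensor) \<Rightarrow> 'e tensor set ring" where
  "nichols_algebra E c = tensor_algebra E Quot nichols_ideal E c"

text \<open>The complex dimension: the least cardinality of a set \<open>F\<close> of tensors whose cosets span the
  quotient, and \<open>\<infinity>\<close> (the infimum of the empty set) if there is no such finite set. A coset is a
  linear combination of the cosets of elements of \<open>F\<close> iff it meets the span of \<open>F\<close>.\<close>

definition nichols_dim :: "'e set \<Rightarrow> ('e \<Rightarrow> 'e \<Rightarrow> 'e tensor) \<Rightarrow> enat" where
  "nichols_dim E c =
     (INF F \<in> {F. finite F \<and> F \<subseteq> carrier (tensor_algebra E) \<and>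
                   (\<forall>X\<in>carrier (nichols_algebra E c). X \<inter> module.span tscale F \<noteq> {})}.
        enat (card F))"


section \<open>The braided vector space \<open>M(\<O>, \<rho>)\<close>\<close>

text \<open>The class \<open>\<O>\<close> is indexed by its own elements, and \<open>x t\<close> is the chosen element of \<open>G\<close> with
  \<open>x t \<triangleright> s = t\<close> (called \<open>g\<^sub>i\<close> for \<open>t = t\<^sub>i\<close>).\<close>

definition class_representatives ::
    "('g, 'm) monoid_scheme \<Rightarrow> 'g set \<Rightarrow> 'g \<Rightarrow> ('g \<Rightarrow> 'g) \<Rightarrow> bool" where
  "class_representatives G \<O> s x \<longleftrightarrow> (\<forall>t\<in>\<O>. x t \<in> carrier G \<and> conj_by G (x t) s = t)"

text \<open>If \<open>B\<close> is a basis of \<open>V\<close> then \<open>M(\<O>, \<rho>)\<close> has basis \<open>\<O> \<times> B\<close>, the pair \<open>(t, b)\<close> standing for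
  \<open>x t \<otimes> b\<close>. For \<open>t \<otimes> x t' = x h \<otimes> \<gamma>\<close> the braiding sends the tensor of \<open>x t \<otimes> b\<close> and \<open>x t' \<otimes> b'\<close> to
  that of \<open>x h \<otimes> \<rho> \<gamma> b'\<close> and \<open>x t \<otimes> b\<close>; the vector \<open>\<rho> \<gamma> b'\<close> is expanded in the basis \<open>B\<close>.\<close>

definition yd_braiding ::
    "('g, 'm) monoid_scheme \<Rightarrow> 'g set \<Rightarrow> 'g \<Rightarrow> ('g \<Rightarrow> 'g) \<Rightarrow> (complex \<Rightarrow> 'v::ab_group_add \<Rightarrow> 'v) \<Rightarrow>
     ('g \<Rightarrow> 'v \<Rightarrow> 'v) \<Rightarrow> 'v set \<Rightarrow> 'g \<times> 'v \<Rightarrow> 'g \<times> 'v \<Rightarrow> ('g \<times> 'v) tensor" where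
  "yd_braiding G \<O> s x scale \<rho> B = (\<lambda>(t, b) (t', b').
     let (h, \<gamma>) = (THE (h, \<gamma>). h \<in> \<O> \<and> \<gamma> \<in> centralizer G s \<and>
                                 t \<otimes>\<^bsub>G\<^esub> x t' = x h \<otimes>\<^bsub>G\<^esub> \<gamma>);
         coord = module.representation scale B (\<rho> \<gamma> b')
     in \<Sum>b'' | coord b'' \<noteq> 0. Poly_Mapping.single [(h, b''), (t, b)] (coord b''))"

end

theory Submission
  imports Defs "HOL-Algebra.Multiplicative_Group"
begin

text \<open>The idea is to find, inside \<open>M(\<O>, \<rho>)\<close>, a braided subspace with twelve basis vectors on which
the braiding is explicit, and in its Nichols algebra an element with infinitely many nonzero
powers.

\<^emph>\<open>The subspace.\<close> Let \<open>\<sigma>\<^sub>j\<close> and \<open>\<tau>\<^sub>j\<close> act on the induced module \<open>M(\<O>, \<rho>)\<close>. By Schur's lemma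
and the hypotheses, \<open>\<sigma>\<^sub>1\<close>, \<open>\<sigma>\<^sub>6\<close> and \<open>\<tau>\<^sub>1\<close> act by \<open>-1\<close> on the vector \<open>1 \<otimes> v\<close> of degree \<open>\<sigma>\<^sub>1\<close> and
on the vector \<open>g \<otimes> w\<close> of degree \<open>\<tau>\<^sub>1\<close>. The rack relations force the orbit of such a vector to
consist of six vectors up to sign, which \<open>\<sigma>\<^sub>j\<close> permutes like the octahedral rack, with sign \<open>-1\<close>
(\<open>octahedral_orbit\<close>); and \<open>\<tau>\<^sub>j\<close> acts on it like \<open>\<sigma>\<^sub>j\<close>, because \<open>\<sigma>\<^sub>j\<^sup>-\<^sup>1 \<tau>\<^sub>j\<close> is the same element
for all \<open>j\<close> and fixes the vector (\<open>octahedral_double_orbit\<close>). So there are vectors \<open>X\<^sub>i\<close> of degree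
\<open>\<sigma>\<^sub>i\<close> and \<open>U\<^sub>i\<close> of degree \<open>\<tau>\<^sub>i\<close> that span a braided subspace: two copies of the octahedral rack
acting on each other by the index, with constant cocycle \<open>-1\<close>.

\<^emph>\<open>Detecting nonzero elements.\<close> The braiding of a rack admits a formula for the action of a
permutation that does not mention reduced words (\<open>nth_hurwitz\<close>). From it follows the usual
factorization of the quantum symmetrizer, which says that an element of the free algebra whose
image in the Nichols algebra vanishes is killed by every sequence of skew derivations down to
degree zero (\<open>derivatives_vanish\<close>).

\<^emph>\<open>The element.\<close> The braided commutators of the \<open>U\<^sub>j\<close> with the \<open>X\<^sub>i\<close> are killed by the
derivations along the \<open>U\<^sub>k\<close>, so on the algebra that they generate the compositions of a derivation
along an \<open>X\<^sub>i\<close> and one along a \<open>U\<^sub>j\<close> are again skew derivations. Three commutators whose indices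
form one orbit are permuted cyclically by their common degree, which has order three on the rack,
and so give an eigenvector for a primitive cube root of unity. This eigenvector and a companion in
the degree with inverse action braid diagonally, of affine Cartan type \<open>A\<^sub>1\<^sup>(\<^sup>1\<^sup>)\<close> at a cube root
of unity. Their braided commutator, of the degree of the null root, has trivial self-braiding, and
there is an ordinary derivation, composed of four skew derivations, which maps its \<open>n\<close>-th power to
a nonzero multiple of \<open>n\<close> times its \<open>(n - 1)\<close>-st power (\<open>dUX_dUX_null_root_power\<close>). Hence no power
vanishes in the Nichols algebra, which is therefore infinite-dimensional.\<close>

section \<open>Hurwitz moves and reduced words\<close>

text \<open>On a basis word, a braiding of rack type \<open>x \<otimes> y \<mapsto> q (x \<rhd> y) \<otimes> x\<close> is \<open>q\<close> times the Hurwitz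
move below. The lemmas of this section show that the moves along a reduced word of a permutation
depend on the permutation only. This is the case of Matsumoto's theorem at hand, with
self-distributivity of \<open>\<rhd>\<close> in the role of the braid equation.\<close>

definition hurwitz_move :: "('a \<Rightarrow> 'a \<Rightarrow> 'a) \<Rightarrow> nat \<Rightarrow> 'a list \<Rightarrow> 'a list" where
  "hurwitz_move op i w = w[i := op (w ! i) (w ! Suc i), Suc i := w ! i]"

definition hurwitz :: "('a \<Rightarrow> 'a \<Rightarrow> 'a) \<Rightarrow> nat list \<Rightarrow> 'a list \<Rightarrow> 'a list" where
  "hurwitz op is w = foldr (hurwitz_move op) is w"

lemma length_hurwitz_move [simp]: "length (hurwitz_move op i w) = length w"
  by (simp add: hurwitz_move_def)

lemma hurwitz_simps [simp]:
  "hurwitz op [] w = w"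
  "hurwitz op (i # is) w = hurwitz_move op i (hurwitz op is w)"
  "hurwitz op (is @ js) w = hurwitz op is (hurwitz op js w)"
  by (simp_all add: hurwitz_def)

lemma length_hurwitz [simp]: "length (hurwitz op is w) = length w"
  by (induction "is") auto

lemma hurwitz_move_append:
  assumes "Suc i < length u"
  shows "hurwitz_move op i (u @ v) = hurwitz_move op i u @ v"
  using assms by (simp add: hurwitz_move_def nth_append list_update_append)

lemma hurwitz_append:
  assumes "\<forall>i\<in>set is. Suc i < length u"
  shows "hurwitz op is (u @ v) = hurwitz op is u @ v"
  using assms by (induction "is") (auto simp: hurwitz_move_append)

lemma set_hurwitz:
  assumes "\<And>a b. a \<in> L \<Longrightarrow> b \<in> L \<Longrightarrow> op a b \<in> L" "\<forall>i\<in>set is. Suc i < length w" "set w \<subseteq> L"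
  shows "set (hurwitz op is w) \<subseteq> L"
  using assms(2)
proof (induction "is")
  case (Cons i "is")
  let ?u = "hurwitz op is w"
  have u: "set ?u \<subseteq> L" "Suc i < length ?u" using Cons by auto
  then have "?u ! i \<in> L" "?u ! Suc i \<in> L"
    by (meson Suc_lessD nth_mem subsetD)+
  then have "op (?u ! i) (?u ! Suc i) \<in> L" "?u ! i \<in> L" using assms(1) by auto
  then show ?case using u(1)
    by (simp add: hurwitz_move_def set_update_subsetI)
qed (use assms in auto)

text \<open>A word (applied from its last letter to its first) is ascending if each letter swaps two
strands that have not crossed before. These are the reduced words; the formulation by steps is the
one that inductions can use.\<close>

fun ascending :: "nat list \<Rightarrow> bool" where
  "ascending [] = True"
| "ascending (i # is) =
    (ascending is \<and> (\<exists>k l. k < l \<and> apply_adj_transps is k = i \<and> apply_adj_transps is l = Suc i))"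

definition crossers :: "(nat \<Rightarrow> nat) \<Rightarrow> nat \<Rightarrow> nat list" where
  "crossers \<pi> l = filter (\<lambda>k. \<pi> l < \<pi> k) [0..<l]"

lemma foldr_self_distrib:
  assumes "\<And>x y z. op x (op y z) = op (op x y) (op x z)"
  shows "foldr (\<lambda>k. op (f k)) ks (op x y) = op (foldr (\<lambda>k. op (f k)) ks x) (foldr (\<lambda>k. op (f k)) ks y)"
  by (induction ks) (simp_all, metis assms)

lemma apply_adj_transps_inj: "apply_adj_transps is x = apply_adj_transps is y \<longleftrightarrow> x = y"
  using permutation_bijective[OF permutation_apply_adj_transps, of "is"]
    by (auto simp: bij_def inj_eq)

text \<open>The reason for the independence of the reduced word: strand \<open>m\<close> ends at position \<open>\<pi> m\<close>, and
its letter is acted upon by the \<^emph>\<open>original\<close> letters of the strands that cross it from the left, in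
their original order. In the induction step strand \<open>l\<close> is crossed by strand \<open>k\<close>, and the strands
left of \<open>k\<close> that cross \<open>k\<close> are those that cross \<open>l\<close>; so the action of the current letter of \<open>k\<close>
can be exchanged for that of its original letter by self-distributivity.\<close>

lemma nth_hurwitz:
  assumes distr: "\<And>x y z. op x (op y z) = op (op x y) (op x z)"
    and "ascending is" "\<forall>i\<in>set is. Suc i < length w" "m < length w"
  shows "hurwitz op is w ! apply_adj_transps is m =
    foldr (\<lambda>k. op (w ! k)) (crossers (apply_adj_transps is) m) (w ! m)"
  using assms(2-)
proof (induction "is" arbitrary: m)
  case Nil
  then show ?case by (simp add: crossers_def)
next
  case (Cons i "is")
  let ?P = "apply_adj_transps is"
  let ?Q = "apply_adj_transps (i # is)"
  let ?u = "hurwitz op is w"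
  let ?F = "\<lambda>ks x. foldr (\<lambda>k. op (w ! k)) ks x"
  obtain k l where kl: "k < l" "?P k = i" "?P l = Suc i" using Cons.prems by auto
  have P: "?P permutes {..<length w}"
    using Cons.prems(2) by (intro permutes_apply_adj_transps) auto
  have l: "l < length w" using permutes_in_image[OF P, of l] kl(3) Cons.prems(2) by simp
  have IH: "?u ! ?P j = ?F (crossers ?P j) (w ! j)" if "j < length w" for j
    using Cons.IH[of j] Cons.prems that by auto
  have Q: "?Q j = (if j = k then Suc i else if j = l then i else ?P j)" for j
    using kl apply_adj_transps_inj[of "is" j k] apply_adj_transps_inj[of "is" j l]
    by (auto simp: Transposition.transpose_def)
  have Pne: "?P j \<noteq> i \<and> ?P j \<noteq> Suc i" if "j \<noteq> k" "j \<noteq> l" for j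
    using kl apply_adj_transps_inj[of "is" j k] apply_adj_transps_inj[of "is" j l] that by auto
  have i: "Suc i < length ?u" using Cons.prems(2) by simp
  consider "m = k" | "m = l" | "m \<noteq> k" "m \<noteq> l" by blast
  then show ?case
  proof cases
    case 1
    have "crossers ?Q m = crossers ?P m"
      unfolding crossers_def
    proof (rule filter_cong[OF refl])
      fix j assume "j \<in> set [0..<m]"
      then have "j \<noteq> k" "j \<noteq> l" using 1 kl by auto
      with Pne[OF this] show "?Q m < ?Q j \<longleftrightarrow> ?P m < ?P j" using 1 kl(2)
        by (auto simp: Q simp del: apply_adj_transps_Cons)
    qed
    moreover have "?Q m = Suc i" using Q 1 by simp
    moreover have "?u ! i = ?F (crossers ?P m) (w ! m)" using IH[of k] kl l 1 by simp
    ultimately show ?thesis using i by (simp add: hurwitz_move_def del: apply_adj_transps_Cons)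
  next
    case 2
    have split: "[0..<l] = [0..<k] @ k # [Suc k..<l]"
      using upt_add_eq_append[of 0 k "l - k"] kl(1) by (simp add: upt_conv_Cons)
    define C where "C = filter (\<lambda>j. Suc i < ?P j) [Suc k..<l]"
    have A: "filter (\<lambda>j. Suc i < ?P j) [0..<k] = crossers ?P k"
      unfolding crossers_def
    proof (rule filter_cong[OF refl])
      fix j assume "j \<in> set [0..<k]"
      then have "j \<noteq> k" "j \<noteq> l" using kl by auto
      with Pne[OF this] show "Suc i < ?P j \<longleftrightarrow> ?P k < ?P j" using kl(2) by auto
    qed
    \<comment> \<open>Before the step, the strands crossing \<open>l\<close> are those crossing \<open>k\<close>, followed by some
      strands between \<open>k\<close> and \<open>l\<close>; the step inserts \<open>k\<close> between the two groups.\<close>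
    have c1: "crossers ?P l = crossers ?P k @ C"
      unfolding A[symmetric] by (simp add: crossers_def split C_def kl)
    have B: "filter (\<lambda>j. j = k \<or> Suc i < ?P j) [0..<k] = crossers ?P k"
      unfolding A[symmetric] by (rule filter_cong) auto
    have C: "filter (\<lambda>j. j = k \<or> Suc i < ?P j) [Suc k..<l] = C"
      unfolding C_def by (rule filter_cong) auto
    have "crossers ?Q l = filter (\<lambda>j. j = k \<or> Suc i < ?P j) [0..<l]"
      unfolding crossers_def
    proof (rule filter_cong[OF refl])
      fix j assume "j \<in> set [0..<l]"
      then show "?Q l < ?Q j \<longleftrightarrow> j = k \<or> Suc i < ?P j"
        using Pne[of j] kl by (auto simp: Q simp del: apply_adj_transps_Cons)
    qed
    also have "\<dots> = crossers ?P k @ k # C"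
      unfolding split filter_append filter.simps B C by simp
    finally have c2: "crossers ?Q l = crossers ?P k @ k # C" .
    have "hurwitz op (i # is) w ! ?Q m = op (?u ! i) (?u ! Suc i)"
      using i 2 kl(1) Q[of l] by (simp add: hurwitz_move_def del: apply_adj_transps_Cons)
    also have "?u ! i = ?F (crossers ?P k) (w ! k)" using IH[of k] kl l by simp
    also have "?u ! Suc i = ?F (crossers ?P k) (?F C (w ! l))" using IH[of l] kl l c1 by simp
    also have "op (?F (crossers ?P k) (w ! k)) \<dots> = ?F (crossers ?Q l) (w ! l)"
      unfolding c2 by (simp add: foldr_self_distrib[OF distr])
    finally show ?thesis using 2 by (simp only:)
  next
    case 3
    have "crossers ?Q m = crossers ?P m"
      unfolding crossers_def
    proof (rule filter_cong[OF refl])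
      fix j assume "j \<in> set [0..<m]"
      show "?Q m < ?Q j \<longleftrightarrow> ?P m < ?P j"
        using 3 kl Pne[OF 3] by (auto simp: Q simp del: apply_adj_transps_Cons)
    qed
    moreover have "?Q m = ?P m" using Q 3 by simp
    ultimately show ?thesis using Pne[OF 3] IH[OF Cons.prems(3)]
      by (simp add: hurwitz_move_def del: apply_adj_transps_Cons)
  qed
qed

lemma hurwitz_cong:
  assumes distr: "\<And>x y z. op x (op y z) = op (op x y) (op x z)"
    and "ascending is" "\<forall>i\<in>set is. Suc i < length w"
    and "ascending js" "\<forall>i\<in>set js. Suc i < length w"
    and eq: "apply_adj_transps is = apply_adj_transps js"
  shows "hurwitz op is w = hurwitz op js w"
proof (rule nth_equalityI)
  fix p assume p: "p < length (hurwitz op is w)"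
  have P: "apply_adj_transps is permutes {..<length w}"
    using assms(3) by (intro permutes_apply_adj_transps) auto
  then obtain m where m: "p = apply_adj_transps is m" "m < length w"
    using p permutes_image[OF P] by (metis (no_types, lifting) imageE length_hurwitz lessThan_iff)
  then show "hurwitz op is w ! p = hurwitz op js w ! p"
    using nth_hurwitz[of op "is" w m, OF distr assms(2,3)]
      nth_hurwitz[of op js w m, OF distr assms(4,5)] eq
    by simp
qed simp

definition inversions :: "nat \<Rightarrow> (nat \<Rightarrow> nat) \<Rightarrow> (nat \<times> nat) set" where
  "inversions n \<pi> = {(a, b). a < b \<and> b < n \<and> \<pi> b < \<pi> a}"

lemma finite_inversions: "finite (inversions n \<pi>)"
  by (rule finite_subset[of _ "{..<n} \<times> {..<n}"]) (auto simp: inversions_def)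

lemma card_inversions_ascent:
  assumes \<pi>: "\<pi> permutes {..<n}" and kl: "k < l" "\<pi> k = i" "\<pi> l = Suc i" and i: "Suc i < n"
  shows "card (inversions n (Transposition.transpose i (Suc i) \<circ> \<pi>)) = Suc (card (inversions n \<pi>))"
proof -
  have l: "l < n" using permutes_in_image[OF \<pi>, of l] kl i by simp
  have inj: "\<pi> x = \<pi> y \<longleftrightarrow> x = y" for x y using permutes_inj[OF \<pi>] by (auto dest: injD)
  have Q: "(Transposition.transpose i (Suc i) \<circ> \<pi>) j =
      (if j = k then Suc i else if j = l then i else \<pi> j)" for j
    using kl inj[of j k] inj[of j l] by (auto simp: Transposition.transpose_def)
  have Pne: "\<pi> j \<noteq> i \<and> \<pi> j \<noteq> Suc i" if "j \<noteq> k" "j \<noteq> l" for j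
    using kl inj[of j k] inj[of j l] that by auto
  have "inversions n (Transposition.transpose i (Suc i) \<circ> \<pi>) = insert (k, l) (inversions n \<pi>)"
  proof (rule Set.set_eqI)
    fix x :: "nat \<times> nat"
    obtain a b where x: "x = (a, b)" by fastforce
    have "(a, b) \<in> inversions n (Transposition.transpose i (Suc i) \<circ> \<pi>)
        \<longleftrightarrow> (a, b) \<in> insert (k, l) (inversions n \<pi>)"
      unfolding inversions_def mem_Collect_eq case_prod_conv Q
      using Pne[of a] Pne[of b] kl l by auto
    with x show "x \<in> inversions n (Transposition.transpose i (Suc i) \<circ> \<pi>)
        \<longleftrightarrow> x \<in> insert (k, l) (inversions n \<pi>)" by simp
  qed
  moreover have "(k, l) \<notin> inversions n \<pi>" using kl by (simp add: inversions_def)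
  ultimately show ?thesis by (simp add: finite_inversions)
qed

text \<open>Each letter changes the number of inversions by one, so a word has at least as many letters
as its permutation has inversions, with equality exactly if no letter removes an inversion.\<close>

lemma ascending_length:
  assumes "\<forall>i\<in>set is. Suc i < n"
  shows "card (inversions n (apply_adj_transps is)) \<le> length is"
    and "ascending is \<longleftrightarrow> card (inversions n (apply_adj_transps is)) = length is"
  using assms
proof (induction "is")
  case Nil
  {
    case 1
    show ?case by (auto simp: inversions_def card_eq_0_iff)
  next
    case 2
    show ?case by (auto simp: inversions_def card_eq_0_iff)
  }
next
  case (Cons i "is")
  let ?P = "apply_adj_transps is"
  have aux: "card (inversions n (apply_adj_transps (i # is))) \<le> length (i # is) \<and>
    (ascending (i # is) \<longleftrightarrow> card (inversions n (apply_adj_transps (i # is))) = length (i # is))"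
    if prems: "\<forall>i\<in>set (i # is). Suc i < n"
  proof -
    have P: "?P permutes {..<n}"
      using prems by (intro permutes_apply_adj_transps) auto
    define k where "k = inv_into UNIV ?P i"
    define l where "l = inv_into UNIV ?P (Suc i)"
    have kl: "?P k = i" "?P l = Suc i"
      unfolding k_def l_def using permutes_surj[OF P] by (simp_all add: surj_f_inv_f)
    have ki: "?P j = i \<longleftrightarrow> j = k" "?P j = Suc i \<longleftrightarrow> j = l" for j
      using kl apply_adj_transps_inj[of "is"] by metis+
    have asc: "ascending (i # is) \<longleftrightarrow> ascending is \<and> k < l" by (auto simp: ki)
    show ?thesis
    proof (cases "k < l")
      case True
      then have "card (inversions n (apply_adj_transps (i # is))) = Suc (card (inversions n ?P))"
        using card_inversions_ascent[OF P True kl] prems by simp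
      then show ?thesis using Cons prems True asc by auto
    next
      case False
      then have lk: "l < k" using kl by (metis linorder_neqE_nat n_not_Suc_n)
      have Q: "apply_adj_transps (i # is) permutes {..<n}"
        using prems by (intro permutes_apply_adj_transps) auto
      have "card (inversions n (Transposition.transpose i (Suc i) \<circ> apply_adj_transps (i # is)))
         = Suc (card (inversions n (apply_adj_transps (i # is))))"
        using card_inversions_ascent[OF Q lk] kl prems by (simp add: Transposition.transpose_def)
      moreover have "Transposition.transpose i (Suc i) \<circ> apply_adj_transps (i # is) = ?P"
        by (simp add: fun_eq_iff)
      ultimately show ?thesis using Cons prems False asc by auto
    qed
  qed
  {
    case 1
    then show ?case using aux by blast
  next
    case 2
    then show ?case using aux by blast
  }
qed

text \<open>The cycle that moves strand \<open>k\<close> to the last of the positions \<open>0, ..., n\<close>. These cycles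
represent the cosets of the permutations that fix \<open>n\<close>.\<close>

lemma apply_rev_upt:
  assumes "k \<le> n"
  shows "apply_adj_transps (rev [k..<n]) j =
    (if j < k then j else if j = k then n else if j \<le> n then j - 1 else j)"
  using assms
proof (induction n arbitrary: j)
  case 0
  then show ?case by simp
next
  case (Suc n)
  show ?case
  proof (cases "k = Suc n")
    case False
    then have "k \<le> n" using Suc by simp
    then show ?thesis by (auto simp: Suc.IH Transposition.transpose_def)
  qed simp
qed

lemma ascending_rev_upt: "ascending (rev [k..<n])"
proof (induction n)
  case (Suc n)
  show ?case
  proof (cases "k \<le> n")
    case True
    have "apply_adj_transps (rev [k..<n]) k = n \<and> apply_adj_transps (rev [k..<n]) (Suc n) = Suc n"
      using True by (simp add: apply_rev_upt)
    moreover have "rev [k..<Suc n] = n # rev [k..<n]" using True by simp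
    moreover have "k < Suc n" using True by simp
    ultimately show ?thesis using Suc by (metis ascending.simps(2))
  qed simp
qed simp

lemma apply_adj_transps_append:
  "apply_adj_transps (is @ js) = apply_adj_transps is \<circ> apply_adj_transps js"
  by (induction "is") (auto simp: o_assoc)

lemma ascending_append_rev_upt:
  assumes "ascending is" "\<forall>i\<in>set is. Suc i < n" "k \<le> n"
  shows "ascending (is @ rev [k..<n])"
  using assms(1,2)
proof (induction "is")
  case (Cons i "is")
  let ?P = "apply_adj_transps is" and ?C = "apply_adj_transps (rev [k..<n])"
  obtain a b where ab: "a < b" "?P a = i" "?P b = Suc i" using Cons.prems by auto
  have P: "?P permutes {..<n}"
    using Cons.prems by (intro permutes_apply_adj_transps) auto
  have b: "b < n" using permutes_in_image[OF P, of b] ab Cons.prems by simp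
  define s where "s j = (if j < k then j else Suc j)" for j
  have s: "?C (s j) = j" if "j < n" for j
    using that assms(3) by (auto simp: s_def apply_rev_upt)
  have "s a < s b" using ab by (simp add: s_def)
  moreover have "apply_adj_transps (is @ rev [k..<n]) (s a) = i"
    "apply_adj_transps (is @ rev [k..<n]) (s b) = Suc i"
    using s[of a] s[of b] ab b by (simp_all add: apply_adj_transps_append)
  moreover have "ascending (is @ rev [k..<n])" using Cons by simp
  ultimately show ?case unfolding append_Cons ascending.simps by blast
qed (simp add: ascending_rev_upt)

text \<open>This is the source of the factorization \<open>S\<^bsub>n+1\<^esub> = (S\<^sub>n \<otimes> id) (1 + c\<^sub>n + c\<^sub>n c\<^bsub>n-1\<^esub> + ...)\<close>
of the quantum symmetrizer: \<open>k\<close> is the strand that ends in the last position.\<close>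

lemma permutes_Suc_decomposition:
  "bij_betw (\<lambda>(k, \<pi>). \<pi> \<circ> apply_adj_transps (rev [k..<n]))
     ({..n} \<times> {\<pi>. \<pi> permutes {..<n}}) {\<pi>. \<pi> permutes {..<Suc n}}"
proof -
  let ?C = "\<lambda>k. apply_adj_transps (rev [k..<n])"
  have C: "?C k permutes {..<Suc n}" for k
    by (intro permutes_apply_adj_transps) auto
  have at_n: "(\<pi> \<circ> ?C k) k = n" if "\<pi> permutes {..<n}" "k \<le> n" for \<pi> k
    using that by (simp add: apply_rev_upt permutes_not_in)
  show ?thesis
  proof (rule bij_betwI')
    fix x y assume "x \<in> {..n} \<times> {\<pi>. \<pi> permutes {..<n}}" "y \<in> {..n} \<times> {\<pi>. \<pi> permutes {..<n}}"
    then obtain k \<pi> l \<tau> where xy: "x = (k, \<pi>)" "y = (l, \<tau>)" "k \<le> n" "l \<le> n"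
      "\<pi> permutes {..<n}" "\<tau> permutes {..<n}" by auto
    have "k = l \<and> \<pi> = \<tau>" if eq: "\<pi> \<circ> ?C k = \<tau> \<circ> ?C l"
    proof -
      have "(\<pi> \<circ> ?C k) k = (\<pi> \<circ> ?C k) l"
        using at_n[OF xy(5,3)] at_n[OF xy(6,4)] eq by simp
      moreover have "inj (\<pi> \<circ> ?C k)"
        using permutes_inj[OF C] permutes_inj[OF xy(5)] by (intro inj_compose)
      ultimately have kl: "k = l" by (rule injD[rotated])
      have "\<pi> = \<tau>"
      proof
        fix a
        obtain b where "a = ?C k b" using permutes_surj[OF C] by (metis surjD)
        then show "\<pi> a = \<tau> a" using eq kl by (metis comp_apply)
      qed
      with kl show ?thesis by simp
    qed
    then show "((\<lambda>(k, \<pi>). \<pi> \<circ> ?C k) x = (\<lambda>(k, \<pi>). \<pi> \<circ> ?C k) y) = (x = y)"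
      using xy by auto
  next
    fix x assume "x \<in> {..n} \<times> {\<pi>. \<pi> permutes {..<n}}"
    then show "(\<lambda>(k, \<pi>). \<pi> \<circ> ?C k) x \<in> {\<pi>. \<pi> permutes {..<Suc n}}"
      using C permutes_subset[of _ "{..<n}" "{..<Suc n}"] by (auto intro!: permutes_compose)
  next
    fix \<tau> assume "\<tau> \<in> {\<pi>. \<pi> permutes {..<Suc n}}"
    then have \<tau>: "\<tau> permutes {..<Suc n}" by simp
    define k where "k = inv_into UNIV \<tau> n"
    define D where "D = inv_into UNIV (?C k)"
    have k: "\<tau> k = n" unfolding k_def using permutes_surj[OF \<tau>] by (simp add: surj_f_inv_f)
    have kn: "k \<le> n" using permutes_in_image[OF \<tau>, of k] k by simp
    have D: "D permutes {..<Suc n}" unfolding D_def using permutes_inv[OF C] .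
    have DC: "D \<circ> ?C k = id" unfolding D_def using permutes_inj[OF C] by simp
    have Dn: "D n = k" using fun_cong[OF DC, of k] kn by (simp add: apply_rev_upt)
    have "\<tau> \<circ> D permutes {..<n}"
    proof (rule permutes_superset[OF permutes_compose[OF D \<tau>]])
      fix x assume "x \<in> {..<Suc n} - {..<n}"
      then have "x = n" by auto
      then show "(\<tau> \<circ> D) x = x" by (simp add: Dn k)
    qed
    moreover have "\<tau> = (\<tau> \<circ> D) \<circ> ?C k" using DC by (simp add: comp_assoc)
    ultimately show "\<exists>x\<in>{..n} \<times> {\<pi>. \<pi> permutes {..<n}}. \<tau> = (\<lambda>(k, \<pi>). \<pi> \<circ> ?C k) x"
      using kn by (intro bexI[of _ "(k, \<tau> \<circ> D)"]) auto
  qed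
qed

lemma ex_ascending:
  assumes "\<pi> permutes {..<n}"
  shows "\<exists>is. (\<forall>i\<in>set is. Suc i < n) \<and> ascending is \<and> apply_adj_transps is = \<pi>"
  using assms
proof (induction n arbitrary: \<pi>)
  case 0
  then show ?case by (intro exI[of _ "[]"]) auto
next
  case (Suc n)
  then have "\<pi> \<in> (\<lambda>(k, \<rho>). \<rho> \<circ> apply_adj_transps (rev [k..<n])) `
      ({..n} \<times> {\<rho>. \<rho> permutes {..<n}})"
    using bij_betw_imp_surj_on[OF permutes_Suc_decomposition[of n]] by simp
  then obtain k \<rho> where k: "k \<le> n" and \<rho>: "\<rho> permutes {..<n}"
    and \<pi>: "\<pi> = \<rho> \<circ> apply_adj_transps (rev [k..<n])"
    by (auto simp only: image_iff mem_Times_iff case_prod_unfold atMost_iff mem_Collect_eq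
        fst_conv snd_conv)
  obtain "is" where "is": "\<forall>i\<in>set is. Suc i < n" "ascending is" "apply_adj_transps is = \<rho>"
    using Suc.IH[OF \<rho>] by blast
  have "\<forall>i\<in>set (is @ rev [k..<n]). Suc i < Suc n" using "is"(1) by auto
  then show ?case
    using ascending_append_rev_upt[OF "is"(2,1) k] "is"(3) \<pi> by (metis apply_adj_transps_append)
qed

lemma reduced_word:
  assumes "\<pi> permutes {..<n}"
  shows "\<forall>i\<in>set (reduced_word n \<pi>). Suc i < n"
    and "apply_adj_transps (reduced_word n \<pi>) = \<pi>"
    and "ascending (reduced_word n \<pi>)"
proof -
  let ?R = "\<lambda>is. (\<forall>i\<in>set is. Suc i < n) \<and> apply_adj_transps is = \<pi>"
  obtain "is" where "is": "?R is" "ascending is" using ex_ascending[OF assms] by blast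
  have rw: "?R (reduced_word n \<pi>)"
    unfolding reduced_word_def by (rule arg_min_natI[of ?R, OF "is"(1)])
  then show 1: "\<forall>i\<in>set (reduced_word n \<pi>). Suc i < n" and 2: "apply_adj_transps (reduced_word n \<pi>) = \<pi>"
    by auto
  have "length (reduced_word n \<pi>) \<le> length is"
    unfolding reduced_word_def by (rule arg_min_nat_le[of ?R, OF "is"(1)])
  also have "\<dots> = card (inversions n \<pi>)" using ascending_length(2)[of "is" n] "is" by simp
  finally show "ascending (reduced_word n \<pi>)"
    using ascending_length[OF 1] 2 by simp
qed

lemma length_reduced_word:
  assumes "\<pi> permutes {..<n}" "ascending is" "\<forall>i\<in>set is. Suc i < n" "apply_adj_transps is = \<pi>"
  shows "length (reduced_word n \<pi>) = length is"
  using ascending_length(2)[of "is" n] ascending_length(2)[of "reduced_word n \<pi>" n]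
    reduced_word[OF assms(1)] assms by simp

section \<open>Tensors as a ring\<close>

text \<open>With concatenation as the addition of the monoid of words, the library's convolution product
turns tensors into a ring whose product is the one of the tensor algebra, so that ring arithmetic
applies to tensors.\<close>

instantiation list :: (type) monoid_add
begin
definition zero_list_def: "0 = []"
definition plus_list_def: "xs + ys = xs @ ys"
instance by standard (simp_all add: zero_list_def plus_list_def)
end

abbreviation (input) lookup where "lookup \<equiv> Poly_Mapping.lookup"
abbreviation (input) keys where "keys \<equiv> Poly_Mapping.keys"
abbreviation (input) single where "single \<equiv> Poly_Mapping.single"

lemma single_mult_single: "single u a * single v b = single (u @ v) (a * b :: complex)"
  by (simp add: mult_single plus_list_def)

lemma single_Nil_1: "single [] (1::complex) = 1"
  by (simp flip: single_one add: zero_list_def)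

lemma tscale_conv_mult: "tscale a p = single [] a * p"
  unfolding tscale_def by (simp add: mult_map_scale_conv_mult zero_list_def)

lemma poly_mapping_sum_single: 
  assumes "finite A" "keys p \<subseteq> A"
  shows "(\<Sum>w\<in>A. single w (lookup p w)) = p"
proof (rule poly_mapping_eqI)
  fix k
  have "lookup (\<Sum>w\<in>A. single w (lookup p w)) k = (\<Sum>w\<in>A. if w = k then lookup p k else 0)"
    unfolding lookup_sum by (intro sum.cong) (auto simp: lookup_single when_def)
  also have "\<dots> = lookup p k" using assms by (auto simp: in_keys_iff)
  finally show "lookup (\<Sum>w\<in>A. single w (lookup p w)) k = lookup p k" .
qed

lemma tensor_mult_eq_times: "tensor_mult p q = p * (q :: 'e tensor)"
proof -
  have "p * q = (\<Sum>u\<in>keys p. single u (lookup p u)) * (\<Sum>v\<in>keys q. single v (lookup q v))"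
    by (simp add: poly_mapping_sum_single)
  also have "\<dots> = tensor_mult p q"
    unfolding tensor_mult_def by (simp add: sum_product single_mult_single)
  finally show ?thesis ..
qed

lemma tscale_simps [simp]:
  "tscale 0 p = 0" "tscale 1 p = p" "tscale a 0 = 0"
  "tscale a (tscale b p) = tscale (a * b) p"
  "tscale a (single w b) = single w (a * b)"
  by (auto intro!: poly_mapping_eqI simp: lookup_tscale lookup_single when_def)

lemma tscale_distrib:
  "tscale a (p + q) = tscale a p + tscale a q"
  "tscale (a + b) p = tscale a p + tscale b p"
  "tscale a (- p) = - tscale a p"
  "tscale a (p - q) = tscale a p - tscale a q"
  by (auto intro!: poly_mapping_eqI simp: lookup_tscale lookup_add lookup_minus algebra_simps)

lemma tscale_sum: "tscale a (\<Sum>i\<in>I. f i) = (\<Sum>i\<in>I. tscale a (f i))"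
  by (induction I rule: infinite_finite_induct) (auto simp: tscale_distrib)

lemma tscale_mult_left [simp]: "tscale a p * q = tscale a (p * (q :: 'e tensor))"
  by (simp add: tscale_conv_mult mult.assoc)

lemma single_Nil_central: "single [] a * p = p * single [] (a :: complex)"
proof -
  have "single [] a * p = (\<Sum>w\<in>keys p. single [] a * single w (lookup p w))"
    by (simp add: sum_distrib_left[symmetric] poly_mapping_sum_single)
  also have "\<dots> = (\<Sum>w\<in>keys p. single w (lookup p w) * single [] a)"
    by (simp add: single_mult_single mult.commute)
  also have "\<dots> = p * single [] a"
    by (simp add: sum_distrib_right[symmetric] poly_mapping_sum_single)
  finally show ?thesis .
qed

lemma tscale_mult_right [simp]: "p * tscale a q = tscale a (p * (q :: 'e tensor))"
  by (metis mult.assoc single_Nil_central tscale_conv_mult)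

text \<open>Linear extension between tensors over possibly different alphabets.\<close>

definition lin_ext :: "('x \<Rightarrow> 'e tensor) \<Rightarrow> ('x \<Rightarrow>\<^sub>0 complex) \<Rightarrow> 'e tensor" where
  "lin_ext f p = (\<Sum>w\<in>keys p. tscale (lookup p w) (f w))"

lemma linear_extension_eq_lin_ext: "linear_extension = lin_ext"
  by (simp add: fun_eq_iff linear_extension_def lin_ext_def)

lemma lin_ext_superset:
  assumes "finite A" "keys p \<subseteq> A"
  shows "lin_ext f p = (\<Sum>w\<in>A. tscale (lookup p w) (f w))"
  unfolding lin_ext_def using assms
  by (intro sum.mono_neutral_left) (auto simp: in_keys_iff)

lemma lin_ext_add: "lin_ext f (p + q) = lin_ext f p + lin_ext f q"
proof -
  let ?A = "keys p \<union> keys q"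
  have "lin_ext f (p + q) = (\<Sum>w\<in>?A. tscale (lookup (p + q) w) (f w))"
    using keys_add[of p q] by (intro lin_ext_superset) auto
  also have "\<dots> = lin_ext f p + lin_ext f q"
    by (simp add: lin_ext_superset[of ?A] lookup_add tscale_distrib sum.distrib)
  finally show ?thesis .
qed

lemma lin_ext_0 [simp]: "lin_ext f 0 = 0"
  by (simp add: lin_ext_def)

lemma lin_ext_single [simp]: "lin_ext f (single w a) = tscale a (f w)"
  by (cases "a = 0") (auto simp: lin_ext_def)

lemma lin_ext_tscale: "lin_ext f (tscale a p) = tscale a (lin_ext f p)"
  by (subst lin_ext_superset[of "keys p"])
     (auto simp: lookup_tscale in_keys_iff lin_ext_def tscale_sum)

lemma lin_ext_sum: "lin_ext f (\<Sum>i\<in>I. g i) = (\<Sum>i\<in>I. lin_ext f (g i))"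
  by (induction I rule: infinite_finite_induct) (auto simp: lin_ext_add)

lemma lin_ext_uminus: "lin_ext f (- p) = - lin_ext f p"
  using lin_ext_add[of f p "- p"] by (simp add: eq_neg_iff_add_eq_0 add.commute)

lemma lin_ext_diff: "lin_ext f (p - q) = lin_ext f p - lin_ext f q"
  using lin_ext_add[of f p "- q"] by (simp add: lin_ext_uminus)

lemma tensor_induct [case_names single add]:
  assumes "\<And>w a. P (single w a)" "\<And>p q. P p \<Longrightarrow> P q \<Longrightarrow> P (p + q)"
  shows "P (p :: 'e tensor)"
proof -
  have "P (\<Sum>w\<in>A. single w (lookup p w))" if "finite A" for A
    using that
  proof (induction A)
    case empty
    show ?case using assms(1)[of undefined 0] by simp
  qed (auto intro: assms)
  from this[of "keys p"] show ?thesis by (simp add: poly_mapping_sum_single)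
qed

text \<open>Homogeneity without any restriction on the letters; this is what locates the braided
factors.\<close>

abbreviation homogeneous :: "nat \<Rightarrow> 'e tensor \<Rightarrow> bool" where
  "homogeneous n p \<equiv> p \<in> tensor_power UNIV n"

lemma homogeneous_iff: "homogeneous n p \<longleftrightarrow> (\<forall>w. lookup p w \<noteq> 0 \<longrightarrow> length w = n)"
  by (auto simp: tensor_power_def in_keys_iff)

lemma tensor_power_mult:
  assumes "p \<in> tensor_power E m" "r \<in> tensor_power E n"
  shows "p * r \<in> tensor_power E (m + n)"
  using keys_mult[of p r] assms unfolding tensor_power_def by (fastforce simp: plus_list_def)

lemma tensor_power_linear:
  "p \<in> tensor_power E n \<Longrightarrow> r \<in> tensor_power E n \<Longrightarrow> p + r \<in> tensor_power E n"
  "p \<in> tensor_power E n \<Longrightarrow> r \<in> tensor_power E n \<Longrightarrow> p - r \<in> tensor_power E n"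
  "p \<in> tensor_power E n \<Longrightarrow> tscale a p \<in> tensor_power E n"
proof -
  show "tscale a p \<in> tensor_power E n" if "p \<in> tensor_power E n"
    using that by (auto simp: tensor_power_def in_keys_iff lookup_tscale)
qed (use keys_add[of p r] keys_diff[of p r] in \<open>unfold tensor_power_def, blast+\<close>)

lemma homogeneous_induct [consumes 1, case_names single add zero]:
  assumes "homogeneous n p"
    and "\<And>w a. length w = n \<Longrightarrow> P (single w a)" "\<And>p q. P p \<Longrightarrow> P q \<Longrightarrow> P (p + q)" "P 0"
  shows "P (p :: 'e tensor)"
proof -
  have "P (\<Sum>w\<in>A. single w (lookup p w))" if "finite A" "A \<subseteq> keys p" for A
    using that assms(1) by (induction A) (auto intro!: assms(2-) simp: tensor_power_def)
  from this[of "keys p"] show ?thesis by (simp add: poly_mapping_sum_single)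
qed

lemma braid_at_linear:
  "braid_at c i (p + q) = braid_at c i p + braid_at c i q"
  "braid_at c i (tscale a p) = tscale a (braid_at c i p)"
  "braid_at c i 0 = 0"
  by (simp_all add: braid_at_def linear_extension_eq_lin_ext lin_ext_add lin_ext_tscale)

lemma braid_at_single:
  "braid_at c i (single w a) =
    tscale a (single (take i w) 1 * (c (w ! i) (w ! Suc i) * single (drop (i + 2) w) 1))"
  by (simp add: braid_at_def linear_extension_eq_lin_ext tensor_mult_eq_times)

text \<open>Tensor factors outside the two braided positions are spectators.\<close>

lemma braid_at_times:
  assumes "homogeneous i p" "homogeneous 2 r"
  shows "braid_at c i (p * (r * s)) = p * (braid_at c 0 r * s)"
  using assms(1)
proof (induction rule: homogeneous_induct)
  case (single u a)
  from assms(2) show ?case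
  proof (induction rule: homogeneous_induct)
    case (single v b)
    show ?case
    proof (induction s rule: tensor_induct)
      case (single w d)
      obtain x y where v: "v = [x, y]"
        using \<open>length v = 2\<close> by (auto simp: length_Suc_conv numeral_2_eq_2)
      have "single u a * (c x y * single w d) =
          tscale a (single u 1) * (c x y * tscale d (single w 1))" by simp
      also have "\<dots> = tscale (d * a) (single u 1 * (c x y * single w 1))"
        by (simp only: tscale_mult_left tscale_mult_right tscale_simps(4))
      finally show ?case using \<open>length u = i\<close> v
        by (simp add: single_mult_single braid_at_single nth_append single_Nil_1 mult.assoc
            mult.commute mult.left_commute)
    qed (simp add: distrib_left braid_at_linear)
  qed (simp_all add: distrib_left distrib_right braid_at_linear)
qed (simp_all add: distrib_right braid_at_linear)

lemma braid_perm_conv_foldr: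
  "braid_perm c n \<pi> = foldr (braid_at c) (reduced_word n \<pi>)"
proof -
  have "foldr (\<circ>) (map f is) id = foldr f is" for f :: "'x \<Rightarrow> 'y \<Rightarrow> 'y" and "is"
    by (induction "is") (auto simp: fun_eq_iff)
  then show ?thesis by (simp add: braid_perm_def)
qed

lemma quantum_symmetrizer_linear:
  "quantum_symmetrizer c n (p + q) = quantum_symmetrizer c n p + quantum_symmetrizer c n q"
  "quantum_symmetrizer c n (tscale a p) = tscale a (quantum_symmetrizer c n p)"
  "quantum_symmetrizer c n 0 = 0"
proof -
  have "foldr (braid_at c) is (p + q) = foldr (braid_at c) is p + foldr (braid_at c) is q"
       "foldr (braid_at c) is (tscale a p) = tscale a (foldr (braid_at c) is p)"
       "foldr (braid_at c) is 0 = 0" for "is"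
    by (induction "is") (simp_all add: braid_at_linear)
  then show "quantum_symmetrizer c n (p + q) = quantum_symmetrizer c n p + quantum_symmetrizer c n q"
  "quantum_symmetrizer c n (tscale a p) = tscale a (quantum_symmetrizer c n p)"
  "quantum_symmetrizer c n 0 = 0"
    by (simp_all add: quantum_symmetrizer_def braid_perm_conv_foldr sum.distrib tscale_sum)
qed

lemma quantum_symmetrizer_sum:
  "quantum_symmetrizer c n (\<Sum>i\<in>I. f i) = (\<Sum>i\<in>I. quantum_symmetrizer c n (f i))"
  by (induction I rule: infinite_finite_induct) (auto simp: quantum_symmetrizer_linear)

section \<open>The quantum symmetrizer and skew derivations\<close>

text \<open>The skew derivation \<open>\<partial>\<^sub>a\<close> of the free algebra: each occurrence of \<open>a\<close> in turn is moved past
all letters on its right, as by the braiding, and deleted.\<close>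

definition skew_derivation_word :: "('a \<Rightarrow> 'a \<Rightarrow> 'a) \<Rightarrow> complex \<Rightarrow> 'a \<Rightarrow> 'a list \<Rightarrow> 'a tensor" where
  "skew_derivation_word op q a w = (\<Sum>k<length w. if w ! k = a
     then single (take k w @ map (op a) (drop (Suc k) w)) (q ^ (length w - Suc k)) else 0)"

definition skew_derivation :: "('a \<Rightarrow> 'a \<Rightarrow> 'a) \<Rightarrow> complex \<Rightarrow> 'a \<Rightarrow> 'a tensor \<Rightarrow> 'a tensor" where
  "skew_derivation op q a = lin_ext (skew_derivation_word op q a)"

lemma nth_hurwitz_rev_upt:
  assumes "k \<le> n" "n < length w" "j < length w"
  shows "hurwitz op (rev [k..<n]) w ! j =
    (if j < k \<or> n < j then w ! j else if j = n then w ! k else op (w ! k) (w ! Suc j))"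
  using assms
proof (induction n arbitrary: j)
  case (Suc n)
  show ?case
  proof (cases "k = Suc n")
    case False
    then have k: "k \<le> n" using Suc by simp
    then show ?thesis using Suc
      by (auto simp: hurwitz_move_def nth_list_update less_Suc_eq not_less)
  qed (use Suc in auto)
qed auto

lemma hurwitz_rev_upt:
  assumes "length w = Suc n" "k \<le> n"
  shows "hurwitz op (rev [k..<n]) w = (take k w @ map (op (w ! k)) (drop (Suc k) w)) @ [w ! k]"
proof (rule nth_equalityI)
  fix j assume "j < length (hurwitz op (rev [k..<n]) w)"
  then have "j < length w" by simp
  then show "hurwitz op (rev [k..<n]) w ! j =
      ((take k w @ map (op (w ! k)) (drop (Suc k) w)) @ [w ! k]) ! j"
    using assms by (subst nth_hurwitz_rev_upt) (auto simp: nth_append)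
qed (use assms in simp)

lemma lookup_times_snoc:
  assumes "homogeneous 1 r"
  shows "lookup (p * r) (u @ [e]) = lookup p u * lookup r [e]"
  using assms
proof (induction rule: homogeneous_induct)
  case (single w b)
  then obtain e' where w: "w = [e']" by (auto simp: length_Suc_conv)
  show ?case
  proof (induction p rule: tensor_induct)
    case (single v a)
    show ?case by (simp add: w single_mult_single lookup_single when_def)
  qed (simp add: distrib_right lookup_add)
qed (simp_all add: distrib_left lookup_add)

lemma reduced_word_0: "reduced_word 0 \<pi> = []" if "\<pi> permutes {..<0}"
  using reduced_word(1)[OF that] by (cases "reduced_word 0 \<pi>") auto

lemma quantum_symmetrizer_0: "quantum_symmetrizer c 0 p = p"
  by (simp add: quantum_symmetrizer_def braid_perm_def reduced_word_0)

text \<open>The vectors \<open>vec a\<close>, for \<open>a\<close> in \<open>L\<close>, span a braided subspace of a braided vector space with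
basis \<open>E\<close>, on which the braiding is that of a rack with a constant cocycle \<open>q\<close>. The vectors need
not belong to the basis; \<open>separated\<close> says that each has a coordinate that vanishes for all others,
which makes them linearly independent in a way that passes to tensor powers.\<close>

locale constant_rack_braiding =
  fixes L :: "'a set" and op :: "'a \<Rightarrow> 'a \<Rightarrow> 'a" and q :: complex
    and c :: "'e \<Rightarrow> 'e \<Rightarrow> 'e tensor" and vec :: "'a \<Rightarrow> 'e tensor" and E :: "'e set"
  assumes finite_L: "finite L"
    and self_distrib: "op x (op y z) = op (op x y) (op x z)"
    and closed: "a \<in> L \<Longrightarrow> b \<in> L \<Longrightarrow> op a b \<in> L"
    and vec: "a \<in> L \<Longrightarrow> vec a \<in> tensor_power E 1"
    and braid: "a \<in> L \<Longrightarrow> b \<in> L \<Longrightarrow> braid_at c 0 (vec a * vec b) = tscale q (vec (op a b) * vec a)"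
    and separated: "a \<in> L \<Longrightarrow> \<exists>e. lookup (vec a) [e] \<noteq> 0 \<and> (\<forall>b\<in>L - {a}. lookup (vec b) [e] = 0)"
begin

definition pure :: "'a list \<Rightarrow> 'e tensor" where
  "pure w = prod_list (map vec w)"

definition embed :: "'a tensor \<Rightarrow> 'e tensor" where
  "embed = lin_ext pure"

abbreviation "D \<equiv> skew_derivation op q"

lemma vec_homogeneous: "a \<in> L \<Longrightarrow> homogeneous 1 (vec a)"
  using vec[of a] by (auto simp: tensor_power_def)

lemma pure_tensor_power: "set w \<subseteq> L \<Longrightarrow> pure w \<in> tensor_power E (length w)"
proof (induction w)
  case Nil
  show ?case by (simp add: pure_def tensor_power_def zero_list_def)
next
  case (Cons a w)
  then have "vec a \<in> tensor_power E 1" "pure w \<in> tensor_power E (length w)" using vec by auto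
  then show ?case using tensor_power_mult[of "vec a" E 1 "pure w" "length w"]
    by (simp add: pure_def)
qed

lemma pure_homogeneous: "set w \<subseteq> L \<Longrightarrow> homogeneous (length w) (pure w)"
  using pure_tensor_power[of w] by (auto simp: tensor_power_def)

lemma braid_at_pure:
  assumes "set w \<subseteq> L" "Suc i < length w"
  shows "braid_at c i (pure w) = tscale q (pure (hurwitz_move op i w))"
proof -
  let ?u = "take i w" and ?v = "drop (Suc (Suc i)) w" and ?a = "w ! i" and ?b = "w ! Suc i"
  have w: "w = ?u @ ?a # ?b # ?v"
    using assms(2) by (metis Cons_nth_drop_Suc Suc_lessD append_take_drop_id)
  have L: "?a \<in> L" "?b \<in> L" "set ?u \<subseteq> L" using assms
    by (auto dest: in_set_takeD)
  have m: "hurwitz_move op i w = ?u @ op ?a ?b # ?a # ?v"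
  proof -
    have "hurwitz_move op i (?u @ ?a # ?b # ?v) = ?u @ op ?a ?b # ?a # ?v"
      using assms(2) by (simp add: hurwitz_move_def nth_append list_update_append min_def)
    then show ?thesis using w by simp
  qed
  have "pure w = pure ?u * ((vec ?a * vec ?b) * pure ?v)"
    by (subst w) (simp add: pure_def mult.assoc)
  also have "braid_at c i \<dots> = pure ?u * (braid_at c 0 (vec ?a * vec ?b) * pure ?v)"
    using pure_homogeneous[OF L(3)]
      tensor_power_mult[OF vec_homogeneous[OF L(1)] vec_homogeneous[OF L(2)]]
      assms(2) by (intro braid_at_times) (simp_all add: min_def numeral_2_eq_2)
  also have "\<dots> = tscale q (pure (hurwitz_move op i w))"
    unfolding m using L by (simp add: braid pure_def mult.assoc)
  finally show ?thesis .
qed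

lemma foldr_braid_at_pure:
  assumes "set w \<subseteq> L" "\<forall>i\<in>set is. Suc i < length w"
  shows "foldr (braid_at c) is (pure w) = tscale (q ^ length is) (pure (hurwitz op is w))"
  using assms(2)
proof (induction "is")
  case (Cons i "is")
  have "set (hurwitz op is w) \<subseteq> L"
    using Cons.prems assms(1) closed by (intro set_hurwitz) auto
  then show ?case using Cons
    by (simp add: braid_at_linear braid_at_pure mult.commute)
qed simp

text \<open>Sort the permutations by the strand \<open>k\<close> that ends in last position. This strand keeps its
letter and acts on all letters to its right, and the remaining strands undergo a permutation of
one strand less.\<close>

lemma quantum_symmetrizer_pure_Suc:
  assumes w: "set w \<subseteq> L" "length w = Suc n"
  shows "quantum_symmetrizer c (Suc n) (pure w) =
    (\<Sum>k\<le>n. tscale (q ^ (n - k))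
       (quantum_symmetrizer c n (pure (take k w @ map (op (w ! k)) (drop (Suc k) w))) * vec (w ! k)))"
proof -
  let ?T = "\<lambda>\<pi>. foldr (braid_at c) (reduced_word (Suc n) \<pi>) (pure w)"
  let ?C = "\<lambda>k. rev [k..<n]"
  let ?w = "\<lambda>k. take k w @ map (op (w ! k)) (drop (Suc k) w)"
  have summand: "?T (\<pi> \<circ> apply_adj_transps (?C k)) =
      tscale (q ^ (n - k)) (foldr (braid_at c) (reduced_word n \<pi>) (pure (?w k)) * vec (w ! k))"
    if k: "k \<le> n" and \<pi>: "\<pi> permutes {..<n}" for k \<pi>
  proof -
    let ?r = "reduced_word n \<pi>" and ?\<rho> = "\<pi> \<circ> apply_adj_transps (?C k)"
    let ?s = "reduced_word (Suc n) ?\<rho>"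
    note r = reduced_word[OF \<pi>]
    have \<rho>: "?\<rho> permutes {..<Suc n}"
    proof -
      have "apply_adj_transps (?C k) permutes {..<Suc n}"
        by (intro permutes_apply_adj_transps) auto
      then show ?thesis using permutes_subset[OF \<pi>, of "{..<Suc n}"]
        by (auto intro!: permutes_compose)
    qed
    note s = reduced_word[OF \<rho>]
    have asc: "ascending (?r @ ?C k)" using ascending_append_rev_upt[OF r(3,1) k] .
    have ind: "\<forall>i\<in>set (?r @ ?C k). Suc i < Suc n" using r(1) by auto
    have app: "apply_adj_transps (?r @ ?C k) = ?\<rho>" using r(2)
      by (simp add: apply_adj_transps_append)
    have len: "length ?s = length ?r + (n - k)"
      using length_reduced_word[OF \<rho> asc ind app] by simp
    have "w ! k \<in> L" using w k by (auto intro!: subsetD[OF w(1)] nth_mem)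
    then have wk: "set (?w k) \<subseteq> L" "length (?w k) = n"
      using w k closed by (auto dest: in_set_takeD in_set_dropD)
    have "?T ?\<rho> = tscale (q ^ length ?s) (pure (hurwitz op ?s w))"
      using s(1) w by (intro foldr_braid_at_pure) auto
    also have "hurwitz op ?s w = hurwitz op (?r @ ?C k) w"
      using asc ind app s w(2) by (intro hurwitz_cong[OF self_distrib]) auto
    also have "\<dots> = hurwitz op ?r (?w k) @ [w ! k]"
      unfolding hurwitz_simps(3) hurwitz_rev_upt[OF w(2) k] using r(1) wk(2)
      by (intro hurwitz_append) simp
    also have "pure \<dots> = pure (hurwitz op ?r (?w k)) * vec (w ! k)"
      by (simp add: pure_def)
    also have "tscale (q ^ length ?s) \<dots> =
        tscale (q ^ (n - k)) (tscale (q ^ length ?r) (pure (hurwitz op ?r (?w k))) * vec (w ! k))"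
      by (simp add: len power_add mult.commute)
    also have "tscale (q ^ length ?r) (pure (hurwitz op ?r (?w k))) =
        foldr (braid_at c) ?r (pure (?w k))"
      using r(1) wk by (intro foldr_braid_at_pure[symmetric]) auto
    finally show ?thesis .
  qed
  have "quantum_symmetrizer c (Suc n) (pure w) = sum ?T {\<pi>. \<pi> permutes {..<Suc n}}"
    by (simp add: quantum_symmetrizer_def braid_perm_conv_foldr)
  also have "\<dots> = (\<Sum>x\<in>{..n} \<times> {\<pi>. \<pi> permutes {..<n}}. ?T ((\<lambda>(k, \<pi>). \<pi> \<circ> apply_adj_transps (?C k)) x))"
    by (rule sum.reindex_bij_betw[OF permutes_Suc_decomposition, symmetric])
  also have "\<dots> = (\<Sum>k\<le>n. \<Sum>\<pi> | \<pi> permutes {..<n}. ?T (\<pi> \<circ> apply_adj_transps (?C k)))"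
    by (simp add: sum.cartesian_product case_prod_unfold)
  also have "\<dots> = (\<Sum>k\<le>n. \<Sum>\<pi> | \<pi> permutes {..<n}.
      tscale (q ^ (n - k)) (foldr (braid_at c) (reduced_word n \<pi>) (pure (?w k)) * vec (w ! k)))"
    using summand by (intro sum.cong) auto
  also have "\<dots> = (\<Sum>k\<le>n. tscale (q ^ (n - k)) (quantum_symmetrizer c n (pure (?w k)) * vec (w ! k)))"
    by (simp add: quantum_symmetrizer_def braid_perm_conv_foldr sum_distrib_right tscale_sum)
  finally show ?thesis .
qed

lemma embed_linear:
  "embed (p + r) = embed p + embed r" "embed (tscale a p) = tscale a (embed p)" "embed 0 = 0"
  "embed (single w a) = tscale a (pure w)" "embed (\<Sum>i\<in>I. f i) = (\<Sum>i\<in>I. embed (f i))"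
  by (simp_all add: embed_def lin_ext_add lin_ext_tscale lin_ext_sum)

lemma embed_tensor_power:
  assumes "p \<in> tensor_power L n"
  shows "embed p \<in> tensor_power E n"
proof -
  have "lookup (embed p) u = 0" if "\<not> (u \<in> lists E \<and> length u = n)" for u
  proof -
    have "lookup (pure w) u = 0" if "w \<in> keys p" for w
      using pure_tensor_power[of w] assms that \<open>\<not> (u \<in> lists E \<and> length u = n)\<close>
      unfolding tensor_power_def by (auto simp: in_keys_iff subset_iff lists_eq_set)
    then show ?thesis
      by (simp add: embed_def lin_ext_def lookup_sum lookup_tscale)
  qed
  then show ?thesis unfolding tensor_power_def by (auto simp: in_keys_iff)
qed

text \<open>The quantum symmetrizer computes all iterated skew derivatives at once: splitting off the
last tensor factor amounts to one derivation.\<close>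

lemma quantum_symmetrizer_embed_Suc:
  assumes "p \<in> tensor_power L (Suc n)"
  shows "quantum_symmetrizer c (Suc n) (embed p) =
    (\<Sum>a\<in>L. quantum_symmetrizer c n (embed (D a p)) * vec a)"
proof -
  let ?S = "quantum_symmetrizer c"
  have word: "?S (Suc n) (pure w) = (\<Sum>a\<in>L. ?S n (embed (skew_derivation_word op q a w)) * vec a)"
    if w: "set w \<subseteq> L" "length w = Suc n" for w
  proof -
    let ?R = "\<lambda>k. tscale (q ^ (n - k))
        (?S n (pure (take k w @ map (op (w ! k)) (drop (Suc k) w))) * vec (w ! k))"
    have "(\<Sum>a\<in>L. ?S n (embed (skew_derivation_word op q a w)) * vec a)
        = (\<Sum>a\<in>L. \<Sum>k\<le>n. if w ! k = a then ?R k else 0)"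
      unfolding skew_derivation_word_def embed_linear quantum_symmetrizer_sum sum_distrib_right
        w(2) lessThan_Suc_atMost
      by (intro sum.cong refl) (auto simp: embed_linear quantum_symmetrizer_linear)
    also have "\<dots> = (\<Sum>k\<le>n. \<Sum>a\<in>L. if w ! k = a then ?R k else 0)"
      by (rule sum.swap)
    also have "\<dots> = (\<Sum>k\<le>n. ?R k)"
    proof (rule sum.cong[OF refl])
      fix k assume "k \<in> {..n}"
      then have "w ! k \<in> L" using w by (auto intro!: subsetD[OF w(1)] nth_mem)
      then show "(\<Sum>a\<in>L. if w ! k = a then ?R k else 0) = ?R k" using finite_L by simp
    qed
    finally show ?thesis using quantum_symmetrizer_pure_Suc[OF w] by simp
  qed
  have keys: "set w \<subseteq> L \<and> length w = Suc n" if "w \<in> keys p" for w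
    using assms that by (auto simp: tensor_power_def)
  have "?S (Suc n) (embed p) = (\<Sum>w\<in>keys p. tscale (lookup p w) (?S (Suc n) (pure w)))"
    by (simp add: embed_def lin_ext_def quantum_symmetrizer_sum quantum_symmetrizer_linear)
  also have "\<dots> = (\<Sum>w\<in>keys p. \<Sum>a\<in>L.
      tscale (lookup p w) (?S n (embed (skew_derivation_word op q a w)) * vec a))"
    using word keys by (simp add: tscale_sum)
  also have "\<dots> = (\<Sum>a\<in>L. \<Sum>w\<in>keys p.
      tscale (lookup p w) (?S n (embed (skew_derivation_word op q a w)) * vec a))"
    by (rule sum.swap)
  also have "\<dots> = (\<Sum>a\<in>L. ?S n (embed (D a p)) * vec a)"
    by (simp add: skew_derivation_def lin_ext_def embed_linear quantum_symmetrizer_sum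
        quantum_symmetrizer_linear sum_distrib_right)
  finally show ?thesis .
qed

lemma skew_derivation_tensor_power:
  assumes "p \<in> tensor_power L (Suc n)" "a \<in> L"
  shows "D a p \<in> tensor_power L n"
proof -
  have "lookup (skew_derivation_word op q a w) u = 0"
    if "w \<in> keys p" "\<not> (u \<in> lists L \<and> length u = n)" for w u
  proof -
    have w: "set w \<subseteq> L" "length w = Suc n" using assms that by (auto simp: tensor_power_def)
    have ne: "u \<noteq> take k w @ map (op a) (drop (Suc k) w)" if "k < length w" for k
    proof
      assume u: "u = take k w @ map (op a) (drop (Suc k) w)"
      then have "length u = n" "set u \<subseteq> L" using that w assms(2) closed
        by (auto dest: in_set_takeD in_set_dropD)
      then show False using \<open>\<not> (u \<in> lists L \<and> length u = n)\<close> by (auto simp: lists_eq_set)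
    qed
    have "lookup (if w ! k = a
        then single (take k w @ map (op a) (drop (Suc k) w)) (q ^ (length w - Suc k)) else 0) u = 0"
      if "k < length w" for k
      using ne[OF that] by (cases "w ! k = a") (simp_all add: lookup_single_not_eq[OF not_sym])
    then show ?thesis
      unfolding skew_derivation_word_def lookup_sum by (intro sum.neutral) blast
  qed
  then have "lookup (D a p) u = 0" if "\<not> (u \<in> lists L \<and> length u = n)" for u
    using that by (auto simp: skew_derivation_def lin_ext_def lookup_sum lookup_tscale)
  then show ?thesis unfolding tensor_power_def by (auto simp: in_keys_iff)
qed

text \<open>An element of the kernel of the quantum symmetrizer is killed by every sequence of
derivations that leads down to degree zero. The last tensor factors of distinct letters are told
apart by the coordinates given by \<open>separated\<close>. Contrapositively, a nonzero iterated derivative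
certifies that the image in the Nichols algebra is nonzero.\<close>

lemma derivatives_vanish:
  assumes "p \<in> tensor_power L n" "quantum_symmetrizer c n (embed p) = 0"
    and "length v = n" "set v \<subseteq> L"
  shows "foldr D v p = 0"
  using assms
proof (induction n arbitrary: p v)
  case 0
  have "keys p \<subseteq> {[]}" using 0 by (auto simp: tensor_power_def)
  then have p: "p = single [] (lookup p [])" using poly_mapping_sum_single[of "{[]}" p] by simp
  have "embed (single [] (lookup p [])) = 0" using 0(2) p by (simp add: quantum_symmetrizer_0)
  then have "lookup p [] = 0"
    by (simp add: embed_linear pure_def tscale_conv_mult zero_list_def)
      (metis lookup_single_eq lookup_zero)
  then show ?case using p 0 by simp
next
  case (Suc n)
  obtain v' a where v: "v = v' @ [a]" "length v' = n"
    using Suc.prems(3) by (metis length_Suc_conv_rev)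
  have a: "a \<in> L" "set v' \<subseteq> L" using Suc.prems(4) v by auto
  let ?R = "\<lambda>b. quantum_symmetrizer c n (embed (D b p))"
  obtain e where e: "lookup (vec a) [e] \<noteq> 0" "\<forall>b\<in>L - {a}. lookup (vec b) [e] = 0"
    using separated[OF a(1)] by blast
  have "?R a = 0"
  proof (rule poly_mapping_eqI)
    fix u
    have "0 = lookup (quantum_symmetrizer c (Suc n) (embed p)) (u @ [e])"
      using Suc.prems by simp
    also have "\<dots> = (\<Sum>b\<in>L. lookup (?R b) u * lookup (vec b) [e])"
      unfolding quantum_symmetrizer_embed_Suc[OF Suc.prems(1)] lookup_sum
      by (intro sum.cong refl lookup_times_snoc vec_homogeneous)
    also have "\<dots> = (\<Sum>b\<in>{a}. lookup (?R b) u * lookup (vec b) [e])"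
      using e(2) finite_L a by (intro sum.mono_neutral_right) auto
    finally show "lookup (?R a) u = lookup 0 u" using e(1) by simp
  qed
  then show ?case
    using Suc.IH[OF skew_derivation_tensor_power[OF Suc.prems(1) a(1)], of v'] v a by simp
qed

end

section \<open>A criterion for infinite dimension\<close>

text \<open>The ideal is spanned by homogeneous elements, so the part of degree \<open>n\<close> of each of its
elements is killed by the quantum symmetrizer. If finitely many tensors span the quotient, then in
a degree \<open>n\<close> above all of theirs every tensor lies in the ideal, up to an element without part of
degree \<open>n\<close>.\<close>

lemma nichols_dim_infinite:
  assumes "\<And>m. \<exists>n\<ge>m. \<exists>p\<in>tensor_power E n. quantum_symmetrizer c n p \<noteq> 0"
  shows "nichols_dim E c = \<infinity>"
proof -
  interpret V: vector_space "tscale :: complex \<Rightarrow> 'a tensor \<Rightarrow> 'a tensor"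
    by (rule vector_space_tscale)
  have False
    if F: "finite F" "F \<subseteq> carrier (tensor_algebra E)"
      "\<forall>X\<in>carrier (nichols_algebra E c). X \<inter> V.span F \<noteq> {}" for F
  proof -
    obtain m where m: "\<And>f w. f \<in> F \<Longrightarrow> w \<in> keys f \<Longrightarrow> length w < m"
    proof -
      have "finite (length ` (\<Union>f\<in>F. keys f))" using F(1) by auto
      then show thesis using that[of "Suc (Max (length ` (\<Union>f\<in>F. keys f)))"]
        by (auto simp: less_Suc_eq_le intro!: Max_ge)
    qed
    obtain n p where n: "n \<ge> max m 2" and p: "p \<in> tensor_power E n" "quantum_symmetrizer c n p \<noteq> 0"
      using assms[of "max m 2"] by blast
    define part :: "'a tensor \<Rightarrow> 'a tensor" where
      "part = lin_ext (\<lambda>w. if length w = n then single w 1 else 0)"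
    have lookup_part: "lookup (part r) w = (if length w = n then lookup r w else 0)" for r w
      by (induction r rule: tensor_induct)
        (auto simp: part_def lin_ext_add lookup_add lookup_single when_def)
    have part_hom: "part r = (if k = n then r else 0)" if "r \<in> tensor_power E k" for r k
      using that by (intro poly_mapping_eqI) (auto simp: lookup_part tensor_power_def in_keys_iff)
    have sub: "V.subspace {r. quantum_symmetrizer c n (part r) = 0}"
      by (auto simp: V.subspace_def part_def lin_ext_add lin_ext_tscale
          quantum_symmetrizer_linear)
    have ideal: "quantum_symmetrizer c n (part r) = 0" if "r \<in> nichols_ideal E c" for r
    proof -
      have "nichols_ideal E c \<subseteq> {r. quantum_symmetrizer c n (part r) = 0}"
        unfolding nichols_ideal_def
        by (rule V.span_minimal[OF _ sub]) (auto simp: part_hom quantum_symmetrizer_linear)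
      then show ?thesis using that by auto
    qed
    have sub': "V.subspace {r. part r = 0}"
      by (auto simp: V.subspace_def part_def lin_ext_add lin_ext_tscale)
    have spanF: "part r = 0" if "r \<in> V.span F" for r
    proof -
      have "part f = 0" if "f \<in> F" for f
        using m[OF that] n by (intro poly_mapping_eqI) (force simp: lookup_part in_keys_iff)
      then have "V.span F \<subseteq> {r. part r = 0}" by (intro V.span_minimal[OF _ sub']) auto
      then show ?thesis using that by auto
    qed
    have pc: "p \<in> carrier (tensor_algebra E)"
      using p(1) by (auto simp: tensor_algebra_def tensor_power_def)
    then have "nichols_ideal E c +>\<^bsub>tensor_algebra E\<^esub> p \<in> carrier (nichols_algebra E c)"
      by (auto simp: nichols_algebra_def FactRing_def A_RCOSETS_def')
    then obtain r where r: "r \<in> nichols_ideal E c +>\<^bsub>tensor_algebra E\<^esub> p" "r \<in> V.span F"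
      using F(3) by blast
    then obtain i where i: "i \<in> nichols_ideal E c" "r = i + p"
      by (auto simp: a_r_coset_def' tensor_algebra_def)
    have "part i + p = 0"
      using spanF[OF r(2)] part_hom[OF p(1)] unfolding i(2) part_def by (simp add: lin_ext_add)
    then have "quantum_symmetrizer c n (part i) + quantum_symmetrizer c n p = 0"
      using quantum_symmetrizer_linear(1)[of c n "part i" p] quantum_symmetrizer_linear(3)[of c n]
        by simp
    then show False using ideal[OF i(1)] p(2) by simp
  qed
  then have no_F: "{F. finite F \<and> F \<subseteq> carrier (tensor_algebra E) \<and>
      (\<forall>X\<in>carrier (nichols_algebra E c). X \<inter> V.span F \<noteq> {})} = {}" by blast
  show ?thesis unfolding nichols_dim_def no_F by (simp add: top_enat_def)
qed

section \<open>The octahedral rack\<close>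

lemma oct_perm_table:
  "oct_perm 1 1 = 1" "oct_perm 1 2 = 5" "oct_perm 1 3 = 2"
  "oct_perm 1 4 = 3" "oct_perm 1 5 = 4" "oct_perm 1 6 = 6"
  "oct_perm 2 1 = 3" "oct_perm 2 2 = 2" "oct_perm 2 3 = 6"
  "oct_perm 2 4 = 4" "oct_perm 2 5 = 1" "oct_perm 2 6 = 5"
  "oct_perm 3 1 = 4" "oct_perm 3 2 = 1" "oct_perm 3 3 = 3"
  "oct_perm 3 4 = 6" "oct_perm 3 5 = 5" "oct_perm 3 6 = 2"
  "oct_perm 4 1 = 5" "oct_perm 4 2 = 2" "oct_perm 4 3 = 1"
  "oct_perm 4 4 = 4" "oct_perm 4 5 = 6" "oct_perm 4 6 = 3"
  "oct_perm 5 1 = 2" "oct_perm 5 2 = 6" "oct_perm 5 3 = 3"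
  "oct_perm 5 4 = 1" "oct_perm 5 5 = 5" "oct_perm 5 6 = 4"
  "oct_perm 6 1 = 1" "oct_perm 6 2 = 3" "oct_perm 6 3 = 4"
  "oct_perm 6 4 = 5" "oct_perm 6 5 = 2" "oct_perm 6 6 = 6"
  by (simp_all add: oct_perm_def)

lemma oct_perm_outside: "j \<notin> {1..6} \<Longrightarrow> oct_perm i j = j" "i \<notin> {1..6} \<Longrightarrow> oct_perm i j = j"
  by (auto simp: oct_perm_def id_outside_supp)

lemma six_cases: "i \<in> {1..6::nat} \<longleftrightarrow> i = 1 \<or> i = 2 \<or> i = 3 \<or> i = 4 \<or> i = 5 \<or> i = 6"
  by auto

lemma oct_perm_closed: "j \<in> {1..6} \<Longrightarrow> oct_perm i j \<in> {1..6}"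
proof (cases "i \<in> {1..6}")
  case True
  assume "j \<in> {1..6}"
  with True show ?thesis unfolding six_cases
    by (elim disjE) (simp_all add: oct_perm_table del: One_nat_def)
qed (simp add: oct_perm_outside)

lemma oct_perm_self_distrib:
  "oct_perm i (oct_perm j k) = oct_perm (oct_perm i j) (oct_perm i k)"
proof (cases "i \<in> {1..6} \<and> j \<in> {1..6} \<and> k \<in> {1..6}")
  case True
  then show ?thesis unfolding six_cases
    by (elim conjE disjE) (simp_all add: oct_perm_table del: One_nat_def)
next
  case False
  then consider "i \<notin> {1..6}" | "j \<notin> {1..6}" | "k \<notin> {1..6}" by blast
  then show ?thesis by cases (simp_all add: oct_perm_outside del: atLeastAtMost_iff)
qed

section \<open>The product rule\<close>

text \<open>The automorphism of the free algebra by which \<open>\<partial>\<^sub>a\<close> is twisted.\<close>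

definition rack_action :: "('a \<Rightarrow> 'a \<Rightarrow> 'a) \<Rightarrow> complex \<Rightarrow> 'a \<Rightarrow> 'a tensor \<Rightarrow> 'a tensor" where
  "rack_action op q a = lin_ext (\<lambda>w. single (map (op a) w) (q ^ length w))"

lemma skew_derivation_word_simps:
  "skew_derivation_word op q a [] = 0"
  "skew_derivation_word op q a (b # w) = single [b] 1 * skew_derivation_word op q a w
     + (if b = a then single (map (op a) w) (q ^ length w) else 0)"
proof -
  show "skew_derivation_word op q a [] = 0" by (simp add: skew_derivation_word_def)
  show "skew_derivation_word op q a (b # w) = single [b] 1 * skew_derivation_word op q a w
     + (if b = a then single (map (op a) w) (q ^ length w) else 0)"
    unfolding skew_derivation_word_def length_Cons sum.lessThan_Suc_shift sum_distrib_left
    by (auto simp: add.commute single_mult_single intro!: sum.cong)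
qed

lemma skew_derivation_word_append:
  "skew_derivation_word op q a (u @ w) = single u 1 * skew_derivation_word op q a w
     + skew_derivation_word op q a u * single (map (op a) w) (q ^ length w)"
proof (induction u)
  case (Cons b u)
  have "single (b # u) 1 * p = single [b] 1 * (single u 1 * p)" for p :: "'a tensor"
    by (simp add: single_mult_single mult.assoc[symmetric])
  then show ?case using Cons
    by (simp add: skew_derivation_word_simps algebra_simps single_mult_single power_add)
qed (simp add: skew_derivation_word_simps single_Nil_1)

lemma skew_derivation_linear:
  "skew_derivation op q a (p + r) = skew_derivation op q a p + skew_derivation op q a r"
  "skew_derivation op q a (p - r) = skew_derivation op q a p - skew_derivation op q a r"
  "skew_derivation op q a (tscale x p) = tscale x (skew_derivation op q a p)"
  "skew_derivation op q a 0 = 0"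
  by (simp_all add: skew_derivation_def lin_ext_add lin_ext_diff lin_ext_tscale)

lemma rack_action_linear:
  "rack_action op q a (p + r) = rack_action op q a p + rack_action op q a r"
  "rack_action op q a (p - r) = rack_action op q a p - rack_action op q a r"
  "rack_action op q a (tscale x p) = tscale x (rack_action op q a p)"
  "rack_action op q a 0 = 0"
  by (simp_all add: rack_action_def lin_ext_add lin_ext_diff lin_ext_tscale)

lemma rack_action_mult:
  "rack_action op q a (p * r) = rack_action op q a p * rack_action op q a r"
proof (induction p rule: tensor_induct)
  case (single u x)
  show ?case
  proof (induction r rule: tensor_induct)
    case (single w y)
    show ?case by (simp add: rack_action_def single_mult_single power_add mult_ac)
  qed (simp add: distrib_left rack_action_linear)
qed (simp add: distrib_right rack_action_linear)

lemma skew_derivation_mult: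
  "skew_derivation op q a (p * r) =
     p * skew_derivation op q a r + skew_derivation op q a p * rack_action op q a r"
proof (induction p rule: tensor_induct)
  case (single u x)
  show ?case
  proof (induction r rule: tensor_induct)
    case (single w y)
    have x: "single u x * p = tscale x (single u 1 * p)" for p
      by (metis mult.right_neutral tscale_mult_left tscale_simps(5))
    have y: "p * single (map (op a) w) (y * q ^ length w) =
        tscale y (p * single (map (op a) w) (q ^ length w))" for p
      by (metis tscale_mult_right tscale_simps(5))
    show ?case
      by (simp add: skew_derivation_def rack_action_def single_mult_single x y)
         (simp add: skew_derivation_word_append tscale_distrib mult.commute)
  qed (simp add: distrib_left rack_action_linear skew_derivation_linear algebra_simps)
qed (simp add: distrib_right skew_derivation_linear algebra_simps)

lemma skew_derivation_single [simp]:
  "skew_derivation op q a (single [b] x) = (if b = a then tscale x 1 else 0)"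
  by (simp add: skew_derivation_def skew_derivation_word_simps single_Nil_1)

lemma rack_action_single [simp]:
  "rack_action op q a (single [b] x) = single [op a b] (q * x)"
  by (simp add: rack_action_def mult.commute)

section \<open>A null root vector over the doubled octahedral rack\<close>

text \<open>Two copies of the octahedral rack that act on each other through the index alone. The letter
\<open>(i, False)\<close> stands for \<open>\<sigma>\<^sub>i\<close> and \<open>(i, True)\<close> for \<open>\<tau>\<^sub>i\<close>; the cocycle is \<open>-1\<close> throughout.\<close>

definition oct_op :: "nat \<times> bool \<Rightarrow> nat \<times> bool \<Rightarrow> nat \<times> bool" where
  "oct_op a b = (oct_perm (fst a) (fst b), snd b)"

abbreviation X :: "nat \<Rightarrow> (nat \<times> bool) tensor" where "X i \<equiv> single [(i, False)] 1"
abbreviation U :: "nat \<Rightarrow> (nat \<times> bool) tensor" where "U i \<equiv> single [(i, True)] 1"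
abbreviation "dX i \<equiv> skew_derivation oct_op (-1) (i, False)"
abbreviation "dU i \<equiv> skew_derivation oct_op (-1) (i, True)"

definition act :: "nat \<Rightarrow> (nat \<times> bool) tensor \<Rightarrow> (nat \<times> bool) tensor" where
  "act i = rack_action oct_op (-1) (i, False)"

lemma act_linear:
  "act i (p + r) = act i p + act i r" "act i (p - r) = act i p - act i r"
  "act i (tscale x p) = tscale x (act i p)" "act i (p * r) = act i p * act i r" "act i 0 = 0"
  by (simp_all add: act_def rack_action_linear rack_action_mult)

lemma rack_action_oct: "rack_action oct_op (-1) (i, b) = act i"
proof -
  have "oct_op (i, b) = oct_op (i, False)" by (simp add: fun_eq_iff oct_op_def)
  then show ?thesis by (simp add: act_def rack_action_def)
qed

lemma act_letter [simp]: "act i (X j) = - X (oct_perm i j)" "act i (U j) = - U (oct_perm i j)"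
  by (simp_all add: act_def oct_op_def single_uminus)

lemma d_letter [simp]:
  "dX i (X j) = (if i = j then 1 else 0)" "dX i (U j) = 0"
  "dU i (U j) = (if i = j then 1 else 0)" "dU i (X j) = 0"
  by auto

lemma d_mult:
  "dX i (p * r) = p * dX i r + dX i p * act i r"
  "dU i (p * r) = p * dU i r + dU i p * act i r"
  by (simp_all add: skew_derivation_mult rack_action_oct)

lemmas d_linear = skew_derivation_linear

text \<open>The braided commutator of \<open>U\<^sub>j\<close> and \<open>X\<^sub>i\<close>, for the braiding with cocycle \<open>-1\<close>.\<close>

definition adj :: "nat \<Rightarrow> nat \<Rightarrow> (nat \<times> bool) tensor" where
  "adj j i = U j * X i + X (oct_perm j i) * U j"

lemma act_adj: "act k (adj j i) = adj (oct_perm k j) (oct_perm k i)"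
  by (simp add: adj_def act_linear oct_perm_self_distrib[of k j i])

lemma dU_adj: "dU k (adj j i) = 0"
  by (simp add: adj_def d_linear d_mult)

lemma dX_adj: "dX k (adj j i) =
    (if k = i then U j else 0) - (if k = oct_perm j i then U (oct_perm k j) else 0)"
  by (simp add: adj_def d_linear d_mult)

text \<open>A subalgebra of the common kernel of the derivations \<open>\<partial>\<close> along the letters \<open>U\<^sub>k\<close> that is
stable under the twists. On it, a derivation along some \<open>X\<^sub>i\<close> followed by one along some \<open>U\<^sub>j\<close> is
again a skew derivation, because the two mixed terms of the product rule vanish (\<open>dUX_mult\<close>
below).\<close>

definition U_free :: "(nat \<times> bool) tensor \<Rightarrow> bool" where
  "U_free p \<longleftrightarrow> (\<forall>k. dU k p = 0) \<and> (\<forall>i k. dU k (act i p) = 0)"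

lemma U_free_intros:
  "U_free (adj j i)" "U_free p \<Longrightarrow> U_free r \<Longrightarrow> U_free (p + r)" "U_free p \<Longrightarrow> U_free r \<Longrightarrow> U_free (p - r)"
  "U_free p \<Longrightarrow> U_free (tscale x p)" "U_free p \<Longrightarrow> U_free r \<Longrightarrow> U_free (p * r)" "U_free 0" "U_free 1"
proof -
  show "U_free 1"
  proof -
    have "act i 1 = 1" for i by (simp flip: single_Nil_1 add: act_def rack_action_def)
    moreover have "dU k 1 = 0" for k
      by (simp flip: single_Nil_1 add: skew_derivation_def skew_derivation_word_simps)
    ultimately show ?thesis by (simp add: U_free_def)
  qed
qed (auto simp: U_free_def act_adj dU_adj d_linear d_mult act_linear)

definition dUX :: "nat \<Rightarrow> nat \<Rightarrow> (nat \<times> bool) tensor \<Rightarrow> (nat \<times> bool) tensor" where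
  "dUX j i p = dU j (dX i p)"

lemma dUX_mult:
  assumes "U_free p" "U_free r"
  shows "dUX j i (p * r) = p * dUX j i r + dUX j i p * act j (act i r)"
  using assms by (simp add: dUX_def U_free_def d_linear d_mult)

lemma dUX_linear:
  "dUX j i (p + r) = dUX j i p + dUX j i r" "dUX j i (p - r) = dUX j i p - dUX j i r"
  "dUX j i (tscale x p) = tscale x (dUX j i p)" "dUX j i 0 = 0"
  by (simp_all add: dUX_def d_linear)

lemma dUX_adj: "dUX l k (adj j i) =
    (if k = i \<and> l = j then 1 else 0) - (if k = oct_perm j i \<and> l = oct_perm k j then 1 else 0)"
  by (auto simp: dUX_def dX_adj d_linear)

text \<open>The two building blocks, for a primitive cube root of unity \<open>\<omega>\<close>. The indices of the three
commutators in \<open>root1\<close> run through an orbit of the square of the braiding; \<open>act 2 \<circ> act 1\<close>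
permutes them cyclically, so \<open>root1\<close> is an eigenvector of this automorphism. The vector \<open>root2\<close> is
made in the same way from an orbit in the degree \<open>\<tau>\<^sub>6 \<sigma>\<^sub>4\<close>. As \<open>oct_perm 6\<close> and \<open>oct_perm 4\<close> are
inverse to \<open>oct_perm 1\<close> and \<open>oct_perm 2\<close>, the automorphism \<open>act 6 \<circ> act 4\<close> is inverse to
\<open>act 2 \<circ> act 1\<close>.\<close>

definition root1 :: "complex \<Rightarrow> (nat \<times> bool) tensor" where
  "root1 \<omega> = adj 2 1 + tscale \<omega> (adj 1 3) + tscale (\<omega> * \<omega>) (adj 3 2)"

definition root2 :: "complex \<Rightarrow> (nat \<times> bool) tensor" where
  "root2 \<omega> = adj 6 4 + tscale \<omega> (adj 4 5) + tscale (\<omega> * \<omega>) (adj 5 6)"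

text \<open>The two vectors braid diagonally, with \<open>q\<^bsub>11\<^esub> = q\<^bsub>22\<^esub> = q\<^bsub>12\<^esub> q\<^bsub>21\<^esub> = \<omega>\<^sup>2\<close>. This is of
Cartan type with the affine matrix \<open>A\<^sub>1\<^sup>(\<^sup>1\<^sup>)\<close>: off-diagonal entries \<open>-2\<close>. The braided commutator
of the two vectors belongs to the null root and braids with itself by \<open>\<omega>\<^sup>6 = 1\<close>, which is why its
powers do not terminate.\<close>

definition null_root :: "complex \<Rightarrow> (nat \<times> bool) tensor" where
  "null_root \<omega> = root1 \<omega> * root2 \<omega> - tscale \<omega> (root2 \<omega> * root1 \<omega>)"

text \<open>The letters of the derivations that send \<open>null_root \<omega> ^ n\<close> to a nonzero scalar.\<close>

definition probe :: "nat \<Rightarrow> (nat \<times> bool) list" where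
  "probe n = concat (replicate n [(2, True), (1, False), (6, True), (4, False)])"

context
  fixes \<omega> :: complex
  assumes \<omega>: "\<omega>\<^sup>2 + \<omega> + 1 = 0"
begin

lemma \<omega>_cube: "\<omega> * (\<omega> * \<omega>) = 1"
proof -
  have "\<omega> * (\<omega> * \<omega>) - 1 = (\<omega> - 1) * (\<omega>\<^sup>2 + \<omega> + 1)" by (simp add: algebra_simps power2_eq_square)
  then show ?thesis using \<omega> by simp
qed

text \<open>The entries of the braiding matrix of the two vectors.\<close>

lemma act_root:
  "act 2 (act 1 (root1 \<omega>)) = tscale (\<omega> * \<omega>) (root1 \<omega>)" "act 2 (act 1 (root2 \<omega>)) = tscale \<omega> (root2 \<omega>)"
  "act 6 (act 4 (root1 \<omega>)) = tscale \<omega> (root1 \<omega>)" "act 6 (act 4 (root2 \<omega>)) = tscale (\<omega> * \<omega>) (root2 \<omega>)"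
  by (simp_all add: root1_def root2_def act_linear act_adj oct_perm_table tscale_distrib \<omega>_cube
      mult.assoc add_ac del: One_nat_def)

lemma act_null_root:
  "act 2 (act 1 (null_root \<omega>)) = null_root \<omega>" "act 6 (act 4 (null_root \<omega>)) = null_root \<omega>"
  by (simp_all add: null_root_def act_linear act_root \<omega>_cube mult.assoc del: One_nat_def)

lemma U_free_root: "U_free (root1 \<omega>)" "U_free (root2 \<omega>)" "U_free (null_root \<omega>)"
  unfolding null_root_def root1_def root2_def by (intro U_free_intros)+

lemma U_free_null_root_power: "U_free (null_root \<omega> ^ n)"
  by (induction n) (auto intro: U_free_intros U_free_root)

lemma tscale_diff: "tscale (a - b) p = tscale a p - tscale b p"
  by (intro poly_mapping_eqI) (simp add: lookup_tscale lookup_minus algebra_simps)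

lemma dUX_root:
  "dUX 2 1 (root1 \<omega>) = tscale (1 - \<omega> * \<omega>) 1" "dUX 2 1 (root2 \<omega>) = 0"
  "dUX 6 4 (root2 \<omega>) = tscale (1 - \<omega> * \<omega>) 1" "dUX 6 4 (root1 \<omega>) = 0"
  by (simp_all add: root1_def root2_def dUX_linear dUX_adj oct_perm_table tscale_distrib tscale_diff
      del: One_nat_def)

text \<open>The commutator is chosen such that the first derivation kills it; the second one does not,
because \<open>q\<^bsub>12\<^esub> q\<^bsub>21\<^esub> = \<omega>\<^sup>2 \<noteq> 1\<close>.\<close>

lemma dUX_null_root:
  "dUX 2 1 (null_root \<omega>) = 0" "dUX 6 4 (null_root \<omega>) = tscale ((1 - \<omega> * \<omega>)\<^sup>2) (root1 \<omega>)"
proof -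
  show "dUX 2 1 (null_root \<omega>) = 0"
    by (simp add: null_root_def dUX_linear dUX_mult U_free_root dUX_root act_root mult.commute
      del: One_nat_def)
  have "dUX 6 4 (null_root \<omega>) = tscale (1 - \<omega> * \<omega>) (root1 \<omega>) - tscale (\<omega> * ((1 - \<omega> * \<omega>) * \<omega>)) (root1 \<omega>)"
    by (simp add: null_root_def dUX_linear dUX_mult U_free_root dUX_root act_root mult.commute)
  also have "\<dots> = tscale ((1 - \<omega> * \<omega>)\<^sup>2) (root1 \<omega>)"
    by (simp add: power2_eq_square algebra_simps flip: tscale_diff)
  finally show "dUX 6 4 (null_root \<omega>) = tscale ((1 - \<omega> * \<omega>)\<^sup>2) (root1 \<omega>)" .
qed

lemma dUX_null_root_power: "dUX 2 1 (null_root \<omega> ^ n) = 0" "U_free (dUX 6 4 (null_root \<omega> ^ n))"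
proof -
  have D1: "dUX j i 1 = 0" for j i
    using dUX_mult[OF U_free_intros(7,7), of j i] by (simp add: dUX_def skew_derivation_def
        skew_derivation_word_simps flip: single_Nil_1)
  show "dUX 2 1 (null_root \<omega> ^ n) = 0"
    by (induction n) (simp_all add: D1 power_Suc2 dUX_mult U_free_root U_free_null_root_power
      dUX_null_root act_null_root del: One_nat_def power_Suc)
  show "U_free (dUX 6 4 (null_root \<omega> ^ n))"
  proof (induction n)
    case (Suc n)
    have "dUX 6 4 (null_root \<omega> ^ Suc n) =
        null_root \<omega> ^ n * dUX 6 4 (null_root \<omega>) + dUX 6 4 (null_root \<omega> ^ n) * null_root \<omega>"
      unfolding power_Suc2 by (simp add: dUX_mult U_free_root U_free_null_root_power act_null_root)
    then show ?case using Suc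
      by (auto simp: dUX_null_root intro!: U_free_intros U_free_root U_free_null_root_power)
  qed (simp add: D1 U_free_intros)
qed

text \<open>The composition of the two derivations is an ordinary (untwisted) derivation on the powers
of the null root vector, since both twists fix this vector. So it differentiates a power as in
calculus.\<close>

lemma dUX_dUX_null_root_power:
  "dUX 2 1 (dUX 6 4 (null_root \<omega> ^ Suc n)) =
    tscale (of_nat (Suc n) * (1 - \<omega> * \<omega>) ^ 3) (null_root \<omega> ^ n)"
proof (induction n)
  case 0
  show ?case by (simp add: dUX_null_root dUX_linear
    dUX_root power3_eq_cube power2_eq_square mult.assoc del: One_nat_def)
next
  case (Suc n)
  have "dUX 6 4 (null_root \<omega> ^ Suc (Suc n)) =
      null_root \<omega> ^ Suc n * dUX 6 4 (null_root \<omega>) + dUX 6 4 (null_root \<omega> ^ Suc n) * null_root \<omega>"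
    unfolding power_Suc2[of "null_root \<omega>" "Suc n"]
      by (simp only: dUX_mult U_free_root U_free_null_root_power act_null_root)
  also have "dUX 2 1 \<dots> = null_root \<omega> ^ Suc n * dUX 2 1 (dUX 6 4 (null_root \<omega>))
      + dUX 2 1 (dUX 6 4 (null_root \<omega> ^ Suc n)) * null_root \<omega>"
    by (simp add: dUX_linear dUX_mult U_free_root U_free_null_root_power
      dUX_null_root_power act_null_root dUX_null_root U_free_intros(4)
        del: power_Suc One_nat_def)
  also have "\<dots> = tscale ((1 - \<omega> * \<omega>) ^ 3) (null_root \<omega> ^ Suc n)
      + tscale (of_nat (Suc n) * (1 - \<omega> * \<omega>) ^ 3) (null_root \<omega> ^ Suc n)"
    unfolding Suc.IH
      by (simp add: dUX_null_root dUX_linear dUX_root power3_eq_cube power2_eq_square mult.assoc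
        power_commutes del: One_nat_def)
  also have "\<dots> = tscale (of_nat (Suc (Suc n)) * (1 - \<omega> * \<omega>) ^ 3) (null_root \<omega> ^ Suc n)"
    unfolding tscale_distrib(2)[symmetric]
    by (rule arg_cong[of _ _ "\<lambda>a. tscale a (null_root \<omega> ^ Suc n)"]) (simp add: algebra_simps)
  finally show ?case .
qed

lemma probe_null_root_power:
  "foldr (skew_derivation oct_op (-1)) (probe n) (null_root \<omega> ^ n) =
    tscale (fact n * (1 - \<omega> * \<omega>) ^ (3 * n)) 1"
proof (induction n)
  case (Suc n)
  let ?D = "skew_derivation oct_op (-1)"
  have lin: "foldr ?D v (tscale x p) = tscale x (foldr ?D v p)" for v x p
    by (induction v) (simp_all add: skew_derivation_linear)
  have "probe (Suc n) = probe n @ [(2, True), (1, False), (6, True), (4, False)]"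
    unfolding probe_def replicate_append_same[symmetric] replicate.simps by simp
  then have "foldr ?D (probe (Suc n)) (null_root \<omega> ^ Suc n) =
      foldr ?D (probe n) (dUX 2 1 (dUX 6 4 (null_root \<omega> ^ Suc n)))"
    by (simp add: dUX_def)
  also have "\<dots> = tscale (fact (Suc n) * (1 - \<omega> * \<omega>) ^ (3 * Suc n)) 1"
    unfolding dUX_dUX_null_root_power lin Suc.IH
      by (simp add: power_add power3_eq_cube algebra_simps)
  finally show ?case .
qed (simp add: probe_def)

end

lemma null_root_power_tensor_power:
  "null_root \<omega> ^ n \<in> tensor_power ({1..6} \<times> UNIV) (4 * n)"
proof -
  let ?T = "tensor_power ({1..6 :: nat} \<times> (UNIV :: bool set))"
  have single: "single w x \<in> ?T k" if "set w \<subseteq> {1..6} \<times> UNIV" "length w = k" for w x k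
    using that by (auto simp: tensor_power_def)
  have adj: "adj j i \<in> ?T 2" if "j \<in> {1..6}" "i \<in> {1..6}" for i j
    unfolding adj_def single_mult_single using that oct_perm_closed[of i j]
    by (intro tensor_power_linear single) auto
  have z: "root1 \<omega> \<in> ?T 2" "root2 \<omega> \<in> ?T 2" unfolding root1_def root2_def
    by (intro tensor_power_linear adj; simp)+
  have "null_root \<omega> \<in> ?T (2 + 2)" unfolding null_root_def
    by (intro tensor_power_linear tensor_power_mult z)
  then show ?thesis
  proof (induction n)
    case (Suc n)
    then show ?case using tensor_power_mult[of "null_root \<omega>" _ 4 "null_root \<omega> ^ n" "4 * n"] by simp
  qed (auto simp: tensor_power_def zero_list_def)
qed

section \<open>Orbits of families of type O\<open>^(2)\<close>\<close>

text \<open>Words in the \<open>\<sigma>\<^sub>j\<close> that conjugate \<open>\<sigma>\<^sub>1\<close> to \<open>\<sigma>\<^sub>i\<close>. They have one letter for \<open>i\<close> from 2 to 5,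
and none or two for \<open>i = 1\<close> and \<open>i = 6\<close>; \<open>oct_sign\<close> is the resulting sign of the cocycle \<open>-1\<close>.\<close>

definition oct_word :: "('g, 'm) monoid_scheme \<Rightarrow> (nat \<Rightarrow> 'g) \<Rightarrow> nat \<Rightarrow> 'g" where
  "oct_word G \<sigma> i = (if i = 1 then \<one>\<^bsub>G\<^esub> else if i = 2 then \<sigma> 5 else if i = 3 then \<sigma> 2
     else if i = 4 then \<sigma> 3 else if i = 5 then \<sigma> 4 else \<sigma> 2 \<otimes>\<^bsub>G\<^esub> \<sigma> 2)"

definition oct_sign :: "nat \<Rightarrow> 'v::ab_group_add \<Rightarrow> 'v" where
  "oct_sign i v = (if i = 1 \<or> i = 6 then v else - v)"

context group
begin

lemma type_O_carrier: "type_O G \<sigma> \<Longrightarrow> i \<in> {1..6} \<Longrightarrow> \<sigma> i \<in> carrier G"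
  by (auto simp: type_O_def)

lemma conj_by_iff:
  assumes "a \<in> carrier G" "b \<in> carrier G" "c \<in> carrier G"
  shows "conj_by G a b = c \<longleftrightarrow> a \<otimes> b = c \<otimes> a"
  using assms by (metis conj_by_def inv_solve_right m_closed)

lemma oct_relation:
  assumes "type_O G \<sigma>" "i \<in> {1..6}" "j \<in> {1..6}"
  shows "\<sigma> i \<otimes> \<sigma> j = \<sigma> (oct_perm i j) \<otimes> \<sigma> i"
  using assms oct_perm_closed[OF assms(3), of i] conj_by_iff type_O_carrier[OF assms(1)]
  unfolding type_O_def by metis

text \<open>The product \<open>\<sigma>\<^sub>1 \<sigma>\<^sub>6\<close> acts trivially on the rack, hence commutes with \<open>\<sigma>\<^sub>2\<close> and \<open>\<sigma>\<^sub>3\<close>, while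
conjugation by these maps it to \<open>\<sigma>\<^sub>3 \<sigma>\<^sub>5\<close> and \<open>\<sigma>\<^sub>4 \<sigma>\<^sub>2\<close>.\<close>

lemma oct_opposite_products:
  assumes "type_O G \<sigma>"
  shows "\<sigma> 2 \<otimes> \<sigma> 4 = \<sigma> 1 \<otimes> \<sigma> 6" "\<sigma> 4 \<otimes> \<sigma> 2 = \<sigma> 1 \<otimes> \<sigma> 6"
    "\<sigma> 3 \<otimes> \<sigma> 5 = \<sigma> 1 \<otimes> \<sigma> 6" "\<sigma> 5 \<otimes> \<sigma> 3 = \<sigma> 1 \<otimes> \<sigma> 6"
proof -
  have c: "\<sigma> 1 \<in> carrier G" "\<sigma> 2 \<in> carrier G" "\<sigma> 3 \<in> carrier G" "\<sigma> 4 \<in> carrier G"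
    "\<sigma> 5 \<in> carrier G" "\<sigma> 6 \<in> carrier G"
    using type_O_carrier[OF assms] by auto
  have r: "\<sigma> i \<otimes> \<sigma> j = \<sigma> (oct_perm i j) \<otimes> \<sigma> i" if "i \<in> {1..6}" "j \<in> {1..6}" for i j
    using oct_relation[OF assms that] .
  have "\<sigma> 3 \<otimes> \<sigma> 5 \<otimes> \<sigma> 2 = \<sigma> 1 \<otimes> \<sigma> 6 \<otimes> \<sigma> 2"
  proof -
    have "\<sigma> 3 \<otimes> \<sigma> 5 \<otimes> \<sigma> 2 = \<sigma> 3 \<otimes> (\<sigma> 2 \<otimes> \<sigma> 6)"
      using r[of 2 6] c by (simp add: m_assoc oct_perm_table)
    also have "\<dots> = \<sigma> 2 \<otimes> \<sigma> 1 \<otimes> \<sigma> 6" using r[of 2 1] c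
      by (simp add: m_assoc[symmetric] oct_perm_table del: One_nat_def)
    also have "\<sigma> 2 \<otimes> \<sigma> 1 = \<sigma> 1 \<otimes> \<sigma> 3" using r[of 1 3] by (simp add: oct_perm_table del: One_nat_def)
    also have "\<sigma> 1 \<otimes> \<sigma> 3 \<otimes> \<sigma> 6 = \<sigma> 1 \<otimes> \<sigma> 6 \<otimes> \<sigma> 2"
      using r[of 6 2] c by (simp add: m_assoc oct_perm_table del: One_nat_def)
    finally show ?thesis .
  qed
  then show 35: "\<sigma> 3 \<otimes> \<sigma> 5 = \<sigma> 1 \<otimes> \<sigma> 6" using c by simp
  have "\<sigma> 4 \<otimes> \<sigma> 2 \<otimes> \<sigma> 3 = \<sigma> 1 \<otimes> \<sigma> 6 \<otimes> \<sigma> 3"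
  proof -
    have "\<sigma> 4 \<otimes> \<sigma> 2 \<otimes> \<sigma> 3 = \<sigma> 4 \<otimes> (\<sigma> 3 \<otimes> \<sigma> 6)"
      using r[of 3 6] c by (simp add: m_assoc oct_perm_table)
    also have "\<dots> = \<sigma> 3 \<otimes> \<sigma> 1 \<otimes> \<sigma> 6" using r[of 3 1] c
      by (simp add: m_assoc[symmetric] oct_perm_table del: One_nat_def)
    also have "\<sigma> 3 \<otimes> \<sigma> 1 = \<sigma> 1 \<otimes> \<sigma> 4" using r[of 1 4] by (simp add: oct_perm_table del: One_nat_def)
    also have "\<sigma> 1 \<otimes> \<sigma> 4 \<otimes> \<sigma> 6 = \<sigma> 1 \<otimes> \<sigma> 6 \<otimes> \<sigma> 3"
      using r[of 6 3] c by (simp add: m_assoc oct_perm_table del: One_nat_def)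
    finally show ?thesis .
  qed
  then show 42: "\<sigma> 4 \<otimes> \<sigma> 2 = \<sigma> 1 \<otimes> \<sigma> 6" using c by simp
  show "\<sigma> 2 \<otimes> \<sigma> 4 = \<sigma> 1 \<otimes> \<sigma> 6" using r[of 2 4] 42 by (simp add: oct_perm_table)
  show "\<sigma> 5 \<otimes> \<sigma> 3 = \<sigma> 1 \<otimes> \<sigma> 6" using r[of 5 3] 35 by (simp add: oct_perm_table)
qed

text \<open>Think of \<open>f k\<close> as \<open>k \<otimes> v\<close> in an induced module, for a vector \<open>v\<close> on which \<open>\<sigma>\<^sub>1\<close> and \<open>\<sigma>\<^sub>6\<close>
act by \<open>-1\<close>. Then the orbit of \<open>v\<close> under the group generated by the \<open>\<sigma>\<^sub>j\<close> consists of only six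
vectors up to sign, and \<open>\<sigma>\<^sub>j\<close> sends the vector of index \<open>i\<close> to minus the vector of index \<open>j \<rhd> i\<close>.
The reason is that every word in the \<open>\<sigma>\<^sub>j\<close> can be rewritten, by the rack relations, into one of
the six chosen words followed by letters \<open>\<sigma>\<^sub>1\<close> and \<open>\<sigma>\<^sub>6\<close>.\<close>

lemma octahedral_orbit:
  fixes f :: "'a \<Rightarrow> 'v::ab_group_add"
  assumes O: "type_O G \<sigma>"
    and f1: "\<And>k. k \<in> carrier G \<Longrightarrow> f (k \<otimes> \<sigma> 1) = - f k"
    and f6: "\<And>k. k \<in> carrier G \<Longrightarrow> f (k \<otimes> \<sigma> 6) = - f k"
    and ij: "i \<in> {1..6}" "j \<in> {1..6}"
  shows "oct_sign i (f (\<sigma> j \<otimes> oct_word G \<sigma> i)) =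
    - oct_sign (oct_perm j i) (f (oct_word G \<sigma> (oct_perm j i)))"
proof -
  have c: "\<sigma> 1 \<in> carrier G" "\<sigma> 2 \<in> carrier G" "\<sigma> 3 \<in> carrier G" "\<sigma> 4 \<in> carrier G"
    "\<sigma> 5 \<in> carrier G" "\<sigma> 6 \<in> carrier G"
    using type_O_carrier[OF O] by auto
  have cI: "\<sigma> i \<in> carrier G" if "i \<in> {1..6}" for i using type_O_carrier[OF O that] .
  have rel: "k \<otimes> \<sigma> a \<otimes> \<sigma> b = k \<otimes> \<sigma> (oct_perm a b) \<otimes> \<sigma> a"
    if "k \<in> carrier G" "a \<in> {1..6}" "b \<in> {1..6}" for k a b
    using oct_relation[OF O that(2,3)] that cI oct_perm_closed[OF that(3), of a]
    by (simp add: m_assoc del: atLeastAtMost_iff)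
  have ray: "f (k \<otimes> \<sigma> r \<otimes> \<sigma> b) = - f (k \<otimes> \<sigma> (oct_perm r b))"
    if k: "k \<in> carrier G" and r: "r = 1 \<or> r = 6" and b: "b \<in> {1..6}" for k r b
  proof -
    have "f (k \<otimes> \<sigma> r \<otimes> \<sigma> b) = f (k \<otimes> \<sigma> (oct_perm r b) \<otimes> \<sigma> r)"
      using rel[OF k _ b, of r] r by auto
    then show ?thesis using r f1 f6 k cI[OF oct_perm_closed[OF b, of r]] by auto
  qed
  have side: "f (k \<otimes> \<sigma> a \<otimes> \<sigma> b) = - f (k \<otimes> \<sigma> (oct_perm (oct_perm a b) a))"
    if k: "k \<in> carrier G" and r: "oct_perm a b = 1 \<or> oct_perm a b = 6"
      and ab: "a \<in> {1..6}" "b \<in> {1..6}" for k a b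
    using rel[OF k ab] ray[OF k r ab(1)] by simp
  have opp: "f (k \<otimes> \<sigma> a \<otimes> \<sigma> b) = f k"
    if k: "k \<in> carrier G" and ab: "(a, b) \<in> {(2, 4), (4, 2), (3, 5), (5, 3)}" for k a b
  proof -
    have "k \<otimes> \<sigma> a \<otimes> \<sigma> b = k \<otimes> \<sigma> 1 \<otimes> \<sigma> 6"
      using ab k c oct_opposite_products[OF O] by (auto simp: m_assoc)
    then show ?thesis using k c f1 f6 by simp
  qed
  \<comment> \<open>The squares of \<open>\<sigma>\<^sub>2, ..., \<sigma>\<^sub>5\<close> agree up to the stabilizer: replace the right factor
    \<open>\<sigma>\<^sub>a\<close> by \<open>- \<sigma>\<^sub>1 \<sigma>\<^sub>b\<close>, and then \<open>\<sigma>\<^sub>a \<sigma>\<^sub>1\<close> by \<open>\<sigma>\<^sub>b \<sigma>\<^sub>a\<close>.\<close>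
  have sq_step: "f (k \<otimes> \<sigma> a \<otimes> \<sigma> a) = f (k \<otimes> \<sigma> b \<otimes> \<sigma> b)"
    if k: "k \<in> carrier G" and ab: "(a, b) \<in> {(2, 3), (3, 4), (4, 5)}" for k a b
  proof -
    have I: "a \<in> {1..6}" "b \<in> {1..6}" "(1::nat) \<in> {1..6}" using ab by auto
    have t: "oct_perm 1 b = a" "oct_perm a 1 = b" "oct_perm a b = 6" "oct_perm 6 a = b"
      using ab by (auto simp: oct_perm_table simp del: One_nat_def)
    have "f (k \<otimes> \<sigma> a \<otimes> \<sigma> a) = - f (k \<otimes> \<sigma> a \<otimes> \<sigma> 1 \<otimes> \<sigma> b)"
      using ray[of "k \<otimes> \<sigma> a" 1 b] k cI I t by simp
    also have "k \<otimes> \<sigma> a \<otimes> \<sigma> 1 = k \<otimes> \<sigma> b \<otimes> \<sigma> a" using rel[OF k I(1,3)] t by simp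
    also have "- f (k \<otimes> \<sigma> b \<otimes> \<sigma> a \<otimes> \<sigma> b) = f (k \<otimes> \<sigma> b \<otimes> \<sigma> b)"
      using side[of "k \<otimes> \<sigma> b" a b] k cI I t by simp
    finally show ?thesis .
  qed
  have sq: "f (k \<otimes> \<sigma> a \<otimes> \<sigma> a) = f (k \<otimes> \<sigma> 2 \<otimes> \<sigma> 2)"
    if k: "k \<in> carrier G" and a: "a \<in> {2, 3, 4, 5}" for k a
    using sq_step[OF k, of 2 3] sq_step[OF k, of 3 4] sq_step[OF k, of 4 5] a by auto
  have f1': "f (\<sigma> 1) = - f \<one>" "f (\<sigma> 6) = - f \<one>" using f1[of \<one>] f6[of \<one>] c by simp_all
  have pair: "f (\<sigma> a \<otimes> \<sigma> b) =
      (if a = b then f (\<sigma> 2 \<otimes> \<sigma> 2)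
       else if (a, b) \<in> {(2, 4), (4, 2), (3, 5), (5, 3)} then f \<one>
       else if a = 1 \<or> a = 6 then - f (\<sigma> (oct_perm a b))
       else - f (\<sigma> (oct_perm (oct_perm a b) a)))"
    if a: "a \<in> {1..6}" and b: "b \<in> {2, 3, 4, 5}" for a b
  proof -
    have bI: "b \<in> {1..6}" using b by auto
    have r: "oct_perm a b = 1 \<or> oct_perm a b = 6"
      if "a \<noteq> b" "(a, b) \<notin> {(2, 4), (4, 2), (3, 5), (5, 3)}" "a \<noteq> 1" "a \<noteq> 6"
      using a b that unfolding six_cases by (elim disjE) (auto simp: oct_perm_table)
    consider (eq) "a = b" | (op) "(a, b) \<in> {(2, 4), (4, 2), (3, 5), (5, 3)}"
      | (N) "a = 1 \<or> a = 6"
      | (P) "a \<noteq> b" "(a, b) \<notin> {(2, 4), (4, 2), (3, 5), (5, 3)}" "a \<noteq> 1" "a \<noteq> 6" by blast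
    then show ?thesis
    proof cases
      case eq
      then show ?thesis using sq[of \<one> b] b c by auto
    next
      case op
      then show ?thesis using opp[of \<one> a b] a cI by auto
    next
      case N
      then have "a \<noteq> b" "(a, b) \<notin> {(2, 4), (4, 2), (3, 5), (5, 3)}" using b by auto
      then show ?thesis
        using \<open>a = 1 \<or> a = 6\<close> ray[of \<one> a b] cI[OF a] cI[OF oct_perm_closed[OF bI, of a]] bI
        by (simp only: if_True if_False) simp
    next
      case P
      have "f (\<sigma> a \<otimes> \<sigma> b) = - f (\<sigma> (oct_perm (oct_perm a b) a))"
        using side[of \<one> a b] r[OF P] a bI cI[OF a] cI[OF oct_perm_closed[OF a, of "oct_perm a b"]]
        by (simp del: atLeastAtMost_iff)
      then show ?thesis using P by (simp only: if_False simp_thms)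
    qed
  qed
  have triple: "f (\<sigma> a \<otimes> (\<sigma> 2 \<otimes> \<sigma> 2)) =
      (if a = 1 \<or> a = 6 then - f (\<sigma> 2 \<otimes> \<sigma> 2) else f (\<sigma> (oct_perm 1 (oct_perm 1 a))))"
    if a: "a \<in> {1..6}" for a
  proof (cases "a = 1 \<or> a = 6")
    case True
    define b where "b = oct_perm a 2"
    have b: "b \<in> {2, 3, 4, 5}" "oct_perm a 2 = b"
      using True unfolding b_def by (auto simp: oct_perm_table simp del: One_nat_def)
    have bI: "b \<in> {1..6}" using b by auto
    have "\<sigma> a \<otimes> (\<sigma> 2 \<otimes> \<sigma> 2) = \<sigma> b \<otimes> \<sigma> a \<otimes> \<sigma> 2"
      using rel[of \<one> a 2] a b c cI bI by (simp add: m_assoc[symmetric])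
    also have "\<dots> = \<sigma> b \<otimes> \<sigma> b \<otimes> \<sigma> a"
      using rel[of "\<sigma> b" a 2] a b c cI bI by simp
    finally have "f (\<sigma> a \<otimes> (\<sigma> 2 \<otimes> \<sigma> 2)) = - f (\<sigma> b \<otimes> \<sigma> b)"
      using True f1 f6 cI[OF bI] by auto
    then show ?thesis using True pair[OF bI b(1)] by simp
  next
    case False
    \<comment> \<open>The index opposite to \<open>a\<close>: two quarter turns around the axis through 1 and 6.\<close>
    define b where "b = oct_perm 1 (oct_perm 1 a)"
    have ab: "(a, b) \<in> {(2, 4), (4, 2), (3, 5), (5, 3)}"
      using a False unfolding six_cases b_def
        by (elim disjE) (simp_all add: oct_perm_table del: One_nat_def)
    then have I: "b \<in> {2, 3, 4, 5}" "b \<in> {1..6}" by auto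
    have "f (\<sigma> a \<otimes> (\<sigma> 2 \<otimes> \<sigma> 2)) = f (\<sigma> a \<otimes> \<sigma> b \<otimes> \<sigma> b)"
      using sq[of "\<sigma> a" b] cI[OF a] c I by (simp add: m_assoc)
    also have "\<sigma> a \<otimes> \<sigma> b = \<sigma> b \<otimes> \<sigma> a"
      using ab oct_opposite_products[OF O] by auto
    also have "f (\<sigma> b \<otimes> \<sigma> a \<otimes> \<sigma> b) = f (\<sigma> b)"
      using opp[of "\<sigma> b" a b] cI[OF I(2)] ab by simp
    finally show ?thesis using False by (simp add: b_def)
  qed
  show ?thesis
  proof -
    consider "i = 1" | "i \<in> {2, 3, 4, 5}" | "i = 6"
      using ij(1) unfolding six_cases by blast
    then show ?thesis
    proof cases
      case 1
      show ?thesis using ij(2) unfolding six_cases 1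
        by (elim disjE) (simp_all add: oct_word_def oct_sign_def oct_perm_table f1' c
          del: One_nat_def)
    next
      case 2
      obtain b where b: "b \<in> {2, 3, 4, 5}" "oct_word G \<sigma> i = \<sigma> b" "b = oct_perm 1 i"
        using 2 by (auto simp: oct_word_def oct_perm_table simp del: One_nat_def)
      show ?thesis using 2 ij(2) unfolding b(2) pair[OF ij(2) b(1)]
        unfolding b(3) six_cases insert_iff empty_iff
        by (elim disjE FalseE)
          (simp_all add: oct_word_def oct_sign_def oct_perm_table f1' c del: One_nat_def)
    next
      case 3
      have w: "oct_word G \<sigma> 6 = \<sigma> 2 \<otimes> \<sigma> 2" by (simp add: oct_word_def)
      show ?thesis using ij(2) unfolding 3 w triple[OF ij(2)] unfolding six_cases
        by (elim disjE) (simp_all add: oct_word_def oct_sign_def oct_perm_table f1' c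
          del: One_nat_def)
    qed
  qed
qed

text \<open>The quotients \<open>\<sigma>\<^sub>j\<^sup>-\<^sup>1 \<tau>\<^sub>j\<close> commute with all \<open>\<sigma>\<^sub>i\<close>, as \<open>\<sigma>\<^sub>j\<close> and \<open>\<tau>\<^sub>j\<close> act alike on them.
Conjugation by the \<open>\<sigma>\<^sub>i\<close> permutes these quotients transitively, so they are all equal.\<close>

lemma octahedral_central_ratio:
  assumes "type_O2 G \<sigma> \<tau>"
  obtains z where "z \<in> carrier G" "\<And>j. j \<in> {1..6} \<Longrightarrow> \<tau> j = \<sigma> j \<otimes> z"
    "\<And>j. j \<in> {1..6} \<Longrightarrow> z \<otimes> \<sigma> j = \<sigma> j \<otimes> z"
proof -
  have O: "type_O G \<sigma>" "type_O G \<tau>" using assms by (auto simp: type_O2_def)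
  note cs = type_O_carrier[OF O(1)] and ct = type_O_carrier[OF O(2)]
  have st: "\<sigma> i \<otimes> \<tau> j = \<tau> (oct_perm i j) \<otimes> \<sigma> i" "\<tau> i \<otimes> \<sigma> j = \<sigma> (oct_perm i j) \<otimes> \<tau> i"
    if "i \<in> {1..6}" "j \<in> {1..6}" for i j
    using assms that cs ct oct_perm_closed[OF that(2), of i] conj_by_iff unfolding type_O2_def
      by metis+
  have one: "(1::nat) \<in> {1..6}" by simp
  define z where "z = inv (\<sigma> 1) \<otimes> \<tau> 1"
  have z: "z \<in> carrier G" using cs[OF one] ct[OF one] by (simp add: z_def)
  have t1: "\<tau> 1 = \<sigma> 1 \<otimes> z" using cs[OF one] ct[OF one] by (simp add: z_def m_assoc[symmetric])
  have comm: "z \<otimes> \<sigma> j = \<sigma> j \<otimes> z" if j: "j \<in> {1..6}" for j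
  proof -
    have "\<sigma> 1 \<otimes> (z \<otimes> \<sigma> j) = \<tau> 1 \<otimes> \<sigma> j" using cs[OF one] cs[OF j] z
      by (simp add: t1 m_assoc del: One_nat_def)
    also have "\<dots> = \<sigma> (oct_perm 1 j) \<otimes> \<sigma> 1 \<otimes> z"
      using st(2)[OF one j] cs[OF one] cs[OF oct_perm_closed[OF j]] z
        by (simp add: t1 m_assoc del: One_nat_def)
    also have "\<dots> = \<sigma> 1 \<otimes> (\<sigma> j \<otimes> z)"
      using oct_relation[OF O(1) one j] cs[OF one] cs[OF j] z
        by (simp add: m_assoc[symmetric] del: One_nat_def)
    finally show ?thesis using cs[OF one] cs[OF j] z by simp
  qed
  have step: "\<tau> (oct_perm j i) = \<sigma> (oct_perm j i) \<otimes> z"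
    if i: "i \<in> {1..6}" and j: "j \<in> {1..6}" and "\<tau> i = \<sigma> i \<otimes> z" for i j
  proof -
    let ?k = "oct_perm j i"
    have k: "?k \<in> {1..6}" by (rule oct_perm_closed[OF i])
    have "\<tau> ?k \<otimes> \<sigma> j = \<sigma> j \<otimes> \<sigma> i \<otimes> z"
      using st(1)[OF j i] that(3) cs[OF i] cs[OF j] z by (simp add: m_assoc)
    also have "\<dots> = \<sigma> ?k \<otimes> z \<otimes> \<sigma> j"
      using oct_relation[OF O(1) j i] comm[OF j] cs[OF j] cs[OF k] z by (simp add: m_assoc)
    finally show ?thesis using cs[OF j] cs[OF k] ct[OF k] z by simp
  qed
  have t3: "\<tau> 3 = \<sigma> 3 \<otimes> z" using step[of 1 2] t1 by (simp add: oct_perm_table del: One_nat_def)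
  have "\<tau> j = \<sigma> j \<otimes> z" if "j \<in> {1..6}" for j
    using that t1 t3 step[of 1 3] step[of 1 4] step[of 1 5] step[of 3 2] unfolding six_cases
    by (auto simp: oct_perm_table simp del: One_nat_def)
  then show thesis using that z comm by blast
qed

text \<open>As \<open>\<tau>\<^sub>1\<close> acts on \<open>v\<close> like \<open>\<sigma>\<^sub>1\<close>, the central ratio fixes \<open>v\<close>, hence its whole orbit: on this
orbit \<open>\<tau>\<^sub>j\<close> acts like \<open>\<sigma>\<^sub>j\<close>.\<close>

lemma octahedral_double_orbit:
  fixes f :: "'a \<Rightarrow> 'v::ab_group_add"
  assumes O: "type_O2 G \<sigma> \<tau>"
    and f1: "\<And>k. k \<in> carrier G \<Longrightarrow> f (k \<otimes> \<sigma> 1) = - f k"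
    and f6: "\<And>k. k \<in> carrier G \<Longrightarrow> f (k \<otimes> \<sigma> 6) = - f k"
    and ft: "\<And>k. k \<in> carrier G \<Longrightarrow> f (k \<otimes> \<tau> 1) = - f k"
    and ij: "i \<in> {1..6}" "j \<in> {1..6}"
  shows "oct_sign i (f ((if b then \<tau> j else \<sigma> j) \<otimes> oct_word G \<sigma> i)) =
    - oct_sign (oct_perm j i) (f (oct_word G \<sigma> (oct_perm j i)))"
proof -
  have O': "type_O G \<sigma>" using O by (simp add: type_O2_def)
  have c: "\<sigma> i \<in> carrier G" if "i \<in> {1..6}" for i using type_O_carrier[OF O' that] .
  obtain z where z: "z \<in> carrier G" "\<And>j. j \<in> {1..6} \<Longrightarrow> \<tau> j = \<sigma> j \<otimes> z"
    "\<And>j. j \<in> {1..6} \<Longrightarrow> z \<otimes> \<sigma> j = \<sigma> j \<otimes> z"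
    using octahedral_central_ratio[OF O] by blast
  have fz: "f (k \<otimes> z) = f k" if k: "k \<in> carrier G" for k
  proof -
    have "f (k \<otimes> z) = - f (k \<otimes> z \<otimes> \<sigma> 1)" using f1 k z by simp
    also have "k \<otimes> z \<otimes> \<sigma> 1 = k \<otimes> \<tau> 1" using z k c by (simp add: m_assoc)
    finally show ?thesis using ft k by simp
  qed
  have w: "oct_word G \<sigma> i \<in> carrier G" using c by (simp add: oct_word_def)
  have "z \<otimes> oct_word G \<sigma> i = oct_word G \<sigma> i \<otimes> z"
  proof -
    have "z \<otimes> (\<sigma> 2 \<otimes> \<sigma> 2) = \<sigma> 2 \<otimes> \<sigma> 2 \<otimes> z"
    proof -
      have "z \<otimes> (\<sigma> 2 \<otimes> \<sigma> 2) = z \<otimes> \<sigma> 2 \<otimes> \<sigma> 2" using z(1) c[of 2] by (simp add: m_assoc)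
      also have "\<dots> = \<sigma> 2 \<otimes> z \<otimes> \<sigma> 2" using z(3)[of 2] by simp
      also have "\<dots> = \<sigma> 2 \<otimes> (z \<otimes> \<sigma> 2)" using z(1) c[of 2] by (simp add: m_assoc)
      also have "\<dots> = \<sigma> 2 \<otimes> (\<sigma> 2 \<otimes> z)" using z(3)[of 2] by simp
      finally show ?thesis using z(1) c[of 2] by (simp add: m_assoc)
    qed
    then show ?thesis using z by (simp add: oct_word_def)
  qed
  then have "f (\<tau> j \<otimes> oct_word G \<sigma> i) = f (\<sigma> j \<otimes> oct_word G \<sigma> i)"
    using z(1) z(2)[OF ij(2)] fz c[OF ij(2)] w by (simp add: m_assoc) (simp add: m_assoc[symmetric])
  then show ?thesis using octahedral_orbit[OF O' f1 f6 ij] by simp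
qed

end

section \<open>Central elements act by scalars\<close>

text \<open>The vectors \<open>w k\<close> are the discrete Fourier transform of the orbit of \<open>v\<close>: each is zero or an
eigenvector, and they add up to \<open>n v\<close>. This works in a space of any dimension.\<close>

lemma finite_order_eigenvector:
  fixes scale :: "complex \<Rightarrow> 'v::ab_group_add \<Rightarrow> 'v" and T :: "'v \<Rightarrow> 'v" and v :: 'v
  assumes "vector_space scale" and T: "Vector_Spaces.linear scale scale T"
    and n: "n > 0" "T ^^ n = id" and v: "v \<noteq> 0"
  shows "\<exists>\<mu> w. w \<noteq> 0 \<and> T w = scale \<mu> w"
proof -
  interpret V: vector_space scale by fact
  interpret T: Vector_Spaces.linear scale scale T by fact
  define \<zeta> where "\<zeta> j = cis (2 * pi * real j / real n)" for j
  have pow: "\<zeta> j ^ k = \<zeta> k ^ j" for j k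
    by (simp add: \<zeta>_def DeMoivre mult_ac)
  have \<zeta>n: "\<zeta> j ^ n = 1" for j
  proof -
    have "real n * (2 * pi * real j / real n) = 2 * pi * real j" using n by simp
    then show ?thesis by (simp add: \<zeta>_def DeMoivre cis_multiple_2pi)
  qed
  have \<zeta>0: "\<zeta> 0 = 1" by (simp add: \<zeta>_def)
  have \<zeta>1: "\<zeta> j \<noteq> 1" if "0 < j" "j < n" for j
  proof
    assume "\<zeta> j = 1"
    then have "\<zeta> j = \<zeta> 0" by (simp add: \<zeta>0)
    moreover have "inj_on \<zeta> {..<n}"
      using bij_betw_imp_inj_on[OF bij_betw_roots_unity[OF n(1)]] by (simp add: \<zeta>_def[abs_def])
    ultimately show False using that by (auto dest: inj_onD)
  qed
  define w where "w k = (\<Sum>j<n. scale (\<zeta> k ^ j) ((T ^^ j) v))" for k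
  have eig: "scale (\<zeta> k) (T (w k)) = w k" for k
  proof -
    have "scale (\<zeta> k) (T (w k)) = (\<Sum>j<n. scale (\<zeta> k ^ Suc j) ((T ^^ Suc j) v))"
      by (simp add: w_def T.sum T.scale V.scale_sum_right)
    also have "\<dots> = (\<Sum>j<Suc n. scale (\<zeta> k ^ j) ((T ^^ j) v)) - v"
      unfolding sum.lessThan_Suc_shift by simp
    also have "\<dots> = w k" using n(2) by (simp add: w_def \<zeta>n)
    finally show ?thesis .
  qed
  have "(\<Sum>k<n. w k) = (\<Sum>j<n. scale (\<Sum>k<n. \<zeta> j ^ k) ((T ^^ j) v))"
    unfolding w_def V.scale_sum_left by (subst sum.swap) (simp add: pow)
  also have "\<dots> = (\<Sum>j\<in>{0}. scale (\<Sum>k<n. \<zeta> j ^ k) ((T ^^ j) v))"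
  proof (rule sum.mono_neutral_right)
    show "\<forall>j\<in>{..<n} - {0}. scale (\<Sum>k<n. \<zeta> j ^ k) ((T ^^ j) v) = 0"
      using \<zeta>1 \<zeta>n by (simp add: geometric_sum)
  qed (use n in auto)
  also have "\<dots> = scale (of_nat n) v" by (simp add: \<zeta>0)
  finally have "(\<Sum>k<n. w k) \<noteq> 0" using v n by simp
  then obtain k where "w k \<noteq> 0" by (meson sum.neutral)
  moreover have "T (w k) = scale (inverse (\<zeta> k)) (w k)"
  proof -
    have "\<zeta> k \<noteq> 0" by (simp add: \<zeta>_def)
    then show ?thesis using arg_cong[OF eig[of k], of "scale (inverse (\<zeta> k))"] by simp
  qed
  ultimately show ?thesis by blast
qed

text \<open>Schur's lemma for the element \<open>s\<close>, which is central in its centralizer: it has finite order,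
so it has an eigenvector, and the eigenspace is a subrepresentation. In particular the description
by which \<open>scalar_of\<close> is defined has a solution.\<close>

lemma central_acts_by_scalar:
  assumes "group G" "finite (carrier G)" "s \<in> carrier G"
    and irr: "irreducible_representation_of (G\<lparr>carrier := centralizer G s\<rparr>) scale \<rho>"
  shows "\<rho> s v = scale (scalar_of scale (\<rho> s)) v"
proof -
  interpret group G by fact
  let ?C = "centralizer G s"
  have vs: "vector_space scale" and lin: "\<And>h. h \<in> ?C \<Longrightarrow> Vector_Spaces.linear scale scale (\<rho> h)"
    and one: "\<rho> \<one>\<^bsub>G\<^esub> = id" and mult: "\<And>h k. h \<in> ?C \<Longrightarrow> k \<in> ?C \<Longrightarrow> \<rho> (h \<otimes>\<^bsub>G\<^esub> k) = \<rho> h \<circ> \<rho> k"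
    and nz: "(UNIV :: 'c set) \<noteq> {0}"
    and simple: "\<And>W. module.subspace scale W \<Longrightarrow> \<forall>h\<in>?C. \<rho> h ` W \<subseteq> W \<Longrightarrow> W = {0} \<or> W = UNIV"
    using irr by (auto simp: irreducible_representation_of_def representation_of_def)
  interpret V: vector_space scale by fact
  have sC: "s \<in> ?C" using assms by (simp add: centralizer_def)
  interpret S: Vector_Spaces.linear scale scale "\<rho> s" by (rule lin[OF sC])
  have "s [^]\<^bsub>G\<^esub> (k::nat) \<in> ?C \<and> \<rho> (s [^]\<^bsub>G\<^esub> k) = \<rho> s ^^ k" for k
  proof (induction k)
    case 0
    show ?case using assms(3) one by (simp add: centralizer_def)
  next
    case (Suc k)
    then have "s [^]\<^bsub>G\<^esub> k \<in> ?C" by blast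
    then show ?case using Suc mult[of "s [^]\<^bsub>G\<^esub> k" s] sC assms(3)
      by (auto simp: centralizer_def m_assoc funpow_Suc_right simp del: funpow.simps)
  qed
  then have ord: "\<rho> s ^^ order G = id" using pow_order_eq_1[OF assms(3)] one by metis
  obtain v0 :: 'c where "v0 \<noteq> 0" using nz by blast
  then obtain \<mu> w where w: "w \<noteq> 0" "\<rho> s w = scale \<mu> w"
    using finite_order_eigenvector[OF vs lin[OF sC] _ ord] order_gt_0_iff_finite assms(2) by metis
  let ?W = "{u. \<rho> s u = scale \<mu> u}"
  have "V.subspace ?W"
    by (auto simp: V.subspace_def S.add S.scale S.zero V.scale_right_distrib)
  moreover have "\<forall>h\<in>?C. \<rho> h ` ?W \<subseteq> ?W"
  proof safe
    fix h u assume h: "h \<in> ?C" and u: "\<rho> s u = scale \<mu> u"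
    interpret H: Vector_Spaces.linear scale scale "\<rho> h" by (rule lin[OF h])
    have "\<rho> s (\<rho> h u) = \<rho> h (\<rho> s u)"
      using mult[OF h sC] mult[OF sC h] h by (simp add: centralizer_def fun_eq_iff)
    then show "\<rho> s (\<rho> h u) = scale \<mu> (\<rho> h u)" by (simp add: u H.scale)
  qed
  ultimately have "?W = UNIV" using simple[of ?W] w by blast
  then have \<mu>: "\<forall>u. \<rho> s u = scale \<mu> u" by blast
  moreover have "scalar_of scale (\<rho> s) = \<mu>"
    unfolding scalar_of_def
  proof (rule the_equality)
    fix q assume "\<forall>u. \<rho> s u = scale q u"
    then have "scale q w = scale \<mu> w" using \<mu> by metis
    then show "q = \<mu>" using w(1) by simp
  qed (use \<mu> in blast)
  ultimately show ?thesis by simp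
qed

section \<open>The module \<open>M(\<O>, \<rho>)\<close>\<close>

locale yetter_drinfeld_data = group G for G (structure) +
  fixes \<O> :: "'a set" and s :: 'a and scale :: "complex \<Rightarrow> 'v::ab_group_add \<Rightarrow> 'v"
    and \<rho> :: "'a \<Rightarrow> 'v \<Rightarrow> 'v" and x :: "'a \<Rightarrow> 'a" and B :: "'v set"
  assumes conjugacy_class: "\<O> \<in> conjugacy_classes G" and s: "s \<in> \<O>"
    and rep: "representation_of (G\<lparr>carrier := centralizer G s\<rparr>) scale \<rho>"
    and reps: "class_representatives G \<O> s x"
    and basis: "\<not> module.dependent scale B" "module.span scale B = UNIV"
begin

abbreviation "C \<equiv> centralizer G s"
abbreviation "coord \<equiv> module.representation scale B"

sublocale V: vector_space scale
  using rep by (simp add: representation_of_def)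

lemma conj_by_closed [simp]: "k \<in> carrier G \<Longrightarrow> t \<in> carrier G \<Longrightarrow> conj_by G k t \<in> carrier G"
  by (simp add: conj_by_def)

lemma conj_by_mult:
  "k \<in> carrier G \<Longrightarrow> l \<in> carrier G \<Longrightarrow> t \<in> carrier G \<Longrightarrow>
    conj_by G (k \<otimes> l) t = conj_by G k (conj_by G l t)"
  by (simp add: conj_by_def m_assoc inv_mult_group)

lemma class_carrier: "t \<in> \<O> \<Longrightarrow> t \<in> carrier G"
  using conjugacy_class by (auto simp: conjugacy_classes_def conj_by_def)

lemma class_conj: "k \<in> carrier G \<Longrightarrow> t \<in> \<O> \<Longrightarrow> conj_by G k t \<in> \<O>"
  using conjugacy_class by (auto simp: conjugacy_classes_def conj_by_mult[symmetric])

lemma s_carrier: "s \<in> carrier G" using class_carrier[OF s] .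

lemma x_carrier: "t \<in> \<O> \<Longrightarrow> x t \<in> carrier G"
  and x_conj: "t \<in> \<O> \<Longrightarrow> conj_by G (x t) s = t"
  using reps by (auto simp: class_representatives_def)

lemma centralizer_iff: "k \<in> carrier G \<Longrightarrow> k \<in> C \<longleftrightarrow> conj_by G k s = s"
  using conj_by_iff[of k s s] s_carrier by (auto simp: centralizer_def)

lemma centralizer_dest: "k \<in> C \<Longrightarrow> k \<in> carrier G" "k \<in> C \<Longrightarrow> conj_by G k s = s"
  using centralizer_iff by (auto simp: centralizer_def)

lemma rho_linear: "k \<in> C \<Longrightarrow> Vector_Spaces.linear scale scale (\<rho> k)"
  and rho_mult: "k \<in> C \<Longrightarrow> l \<in> C \<Longrightarrow> \<rho> (k \<otimes> l) v = \<rho> k (\<rho> l v)"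
  using rep by (auto simp: representation_of_def)

lemma stabilizing_part:
  assumes "k \<in> carrier G" "t \<in> \<O>"
  shows "inv (x (conj_by G k t)) \<otimes> k \<otimes> x t \<in> C"
proof -
  let ?h = "conj_by G k t"
  have h: "?h \<in> \<O>" using class_conj assms by simp
  note c = assms(1) x_carrier[OF assms(2)] x_carrier[OF h] s_carrier
  have "conj_by G (inv (x ?h) \<otimes> k \<otimes> x t) s = conj_by G (inv (x ?h)) ?h"
    using c x_conj[OF assms(2)] class_carrier[OF assms(2)] by (simp add: conj_by_mult)
  also have "\<dots> = conj_by G (inv (x ?h)) (conj_by G (x ?h) s)" using x_conj[OF h] by simp
  also have "\<dots> = s" using c by (simp add: conj_by_mult[symmetric]) (simp add: conj_by_def)
  finally show ?thesis using c by (simp add: centralizer_iff)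
qed

text \<open>The vector of \<open>V\<close> for which \<open>k \<otimes> v\<close>, in the module induced from the centralizer, equals
\<open>x\<^sub>t \<otimes> translate k v\<close>; here \<open>t\<close> is the conjugate of \<open>s\<close> by \<open>k\<close>. With this, no representative of a
coset has to be singled out in computations.\<close>

definition translate :: "'a \<Rightarrow> 'v \<Rightarrow> 'v" where
  "translate k v = \<rho> (inv (x (conj_by G k s)) \<otimes> k) v"

lemma translate_C:
  assumes "k \<in> carrier G"
  shows "inv (x (conj_by G k s)) \<otimes> k \<in> C"
proof -
  have h: "conj_by G k s \<in> \<O>" using class_conj assms s by simp
  note c = assms x_carrier[OF h] s_carrier
  have "conj_by G (inv (x (conj_by G k s)) \<otimes> k) s = conj_by G (inv (x (conj_by G k s))) (conj_by G k s)"
    using c by (simp add: conj_by_mult)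
  also have "\<dots> = conj_by G (inv (x (conj_by G k s))) (conj_by G (x (conj_by G k s)) s)"
    using x_conj[OF h] by simp
  also have "\<dots> = s" using c by (simp add: conj_by_mult[symmetric]) (simp add: conj_by_def)
  finally show ?thesis using c by (simp add: centralizer_iff)
qed

lemma translate_mult_C:
  assumes "k \<in> carrier G" "l \<in> C"
  shows "translate (k \<otimes> l) v = translate k (\<rho> l v)"
proof -
  have l: "l \<in> carrier G" "conj_by G l s = s" using assms(2) by (auto dest: centralizer_dest)
  have "conj_by G (k \<otimes> l) s = conj_by G k s" using assms l s_carrier by (simp add: conj_by_mult)
  moreover have "x (conj_by G k s) \<in> carrier G" using x_carrier class_conj assms s by simp
  ultimately show ?thesis
    using rho_mult[OF translate_C[OF assms(1)] assms(2)] assms l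
      by (simp add: translate_def m_assoc)
qed

text \<open>The braiding acts on the second component by left translation: \<open>t\<close> sends \<open>k \<otimes> v\<close> to
\<open>t k \<otimes> v\<close>.\<close>

lemma translate_translate:
  assumes "t \<in> carrier G" "k \<in> carrier G"
  shows "\<rho> (inv (x (conj_by G t (conj_by G k s))) \<otimes> t \<otimes> x (conj_by G k s)) (translate k v) =
    translate (t \<otimes> k) v"
proof -
  let ?h = "conj_by G k s"
  have h: "?h \<in> \<O>" "conj_by G t ?h \<in> \<O>" using class_conj assms s by simp_all
  note c = assms x_carrier[OF h(1)] x_carrier[OF h(2)] s_carrier
  have "inv (x (conj_by G t ?h)) \<otimes> t \<otimes> x ?h \<otimes> (inv (x ?h) \<otimes> k) = inv (x (conj_by G t ?h)) \<otimes> (t \<otimes> k)"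
    using c by (simp add: m_assoc) (simp add: m_assoc[symmetric])
  then show ?thesis
    using rho_mult[OF stabilizing_part[OF assms(1) h(1)] translate_C[OF assms(2)]] c
    by (simp add: translate_def conj_by_mult)
qed

lemma translate_linear: "k \<in> carrier G \<Longrightarrow> Vector_Spaces.linear scale scale (translate k)"
  using rho_linear[OF translate_C] unfolding translate_def by simp

lemma translate_eq_0: 
  assumes "k \<in> carrier G" "translate k v = 0"
  shows "v = 0"
proof -
  let ?g = "inv (x (conj_by G k s)) \<otimes> k"
  have g: "?g \<in> C" by (rule translate_C[OF assms(1)])
  then have gc: "?g \<in> carrier G" "conj_by G ?g s = s" by (auto dest: centralizer_dest)
  have "conj_by G (inv ?g) s = conj_by G (inv ?g) (conj_by G ?g s)" using gc(2) by simp
  also have "\<dots> = s" using gc(1) s_carrier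
    by (simp add: conj_by_mult[symmetric] del: inv_mult_group) (simp add: conj_by_def)
  finally have i: "inv ?g \<in> C" using gc(1) by (simp add: centralizer_iff)
  interpret I: Vector_Spaces.linear scale scale "\<rho> (inv ?g)" by (rule rho_linear[OF i])
  have "\<rho> (inv ?g \<otimes> ?g) v = 0" using assms(2) I.zero unfolding translate_def rho_mult[OF i g]
    by simp
  moreover have "\<rho> \<one> = id" using rep by (simp add: representation_of_def)
  ultimately show ?thesis using gc(1) by (simp add: l_inv del: inv_mult_group)
qed

text \<open>The element \<open>x\<^sub>t \<otimes> v\<close> of \<open>M(\<O>, \<rho>)\<close>, as a tensor of degree one.\<close>

definition vec :: "'a \<Rightarrow> 'v \<Rightarrow> ('a \<times> 'v) tensor" where
  "vec t v = (\<Sum>b | coord v b \<noteq> 0. single [(t, b)] (coord v b))"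

lemma lookup_vec: "lookup (vec t v) w = (case w of [(t', b)] \<Rightarrow> if t' = t then coord v b else 0 | _ \<Rightarrow> 0)"
proof -
  have fin: "finite {b. coord v b \<noteq> 0}" by (rule V.finite_representation)
  have "lookup (vec t v) w = (\<Sum>b | coord v b \<noteq> 0. if w = [(t, b)] then coord v b else 0)"
    unfolding vec_def lookup_sum by (intro sum.cong) (auto simp: lookup_single when_def)
  also have "\<dots> = (case w of [(t', b)] \<Rightarrow> if t' = t then coord v b else 0 | _ \<Rightarrow> 0)"
    using fin by (auto split: list.split)
  finally show ?thesis .
qed

lemma coord_add: "coord (u + v) b = coord u b + coord v b"
  using V.representation_add[OF basis(1)] basis(2) by auto

lemma coord_scale: "coord (scale a v) b = a * coord v b"
  using V.representation_scale[OF basis(1)] basis(2) by auto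

lemma vec_linear: "vec t (u + v) = vec t u + vec t v" "vec t (scale a v) = tscale a (vec t v)"
  by (auto intro!: poly_mapping_eqI simp: lookup_vec lookup_add lookup_tscale coord_add coord_scale
    split: list.split)

lemma vec_0 [simp]: "vec t 0 = 0"
  using vec_linear(2)[of t 0 0] by simp

lemma vec_sum: "vec t (\<Sum>i\<in>I. f i) = (\<Sum>i\<in>I. vec t (f i))"
  by (induction I rule: infinite_finite_induct) (auto simp: vec_linear)

lemma coord_in_B: "coord v b \<noteq> 0 \<Longrightarrow> b \<in> B"
  by (rule V.representation_ne_zero)

lemma sum_coord: "(\<Sum>b | coord v b \<noteq> 0. scale (coord v b) b) = v"
  using V.sum_nonzero_representation_eq[OF basis(1)] basis(2) by simp

text \<open>The pair \<open>(h, \<gamma>)\<close> is determined because \<open>h\<close> must be the conjugate of \<open>s\<close> by \<open>t x\<^bsub>t'\<^esub>\<close>.\<close>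

lemma yd_braiding_basis:
  assumes "t \<in> \<O>" "t' \<in> \<O>"
  shows "yd_braiding G \<O> s x scale \<rho> B (t, b) (t', b') =
    vec (conj_by G t t') (\<rho> (inv (x (conj_by G t t')) \<otimes> t \<otimes> x t') b') * single [(t, b)] 1"
proof -
  let ?h = "conj_by G t t'"
  let ?\<gamma> = "inv (x ?h) \<otimes> t \<otimes> x t'"
  have h: "?h \<in> \<O>" using assms class_conj class_carrier by blast
  note c = class_carrier[OF assms(1)] class_carrier[OF assms(2)] x_carrier[OF assms(2)]
    x_carrier[OF h] s_carrier
  have "(THE (h, \<gamma>). h \<in> \<O> \<and> \<gamma> \<in> C \<and> t \<otimes> x t' = x h \<otimes> \<gamma>) = (?h, ?\<gamma>)"
  proof (rule the_equality)
    show "case (?h, ?\<gamma>) of (h, \<gamma>) \<Rightarrow> h \<in> \<O> \<and> \<gamma> \<in> C \<and> t \<otimes> x t' = x h \<otimes> \<gamma>"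
      using h stabilizing_part[OF c(1) assms(2)] c by (simp add: m_assoc[symmetric])
  next
    fix p assume "case p of (h, \<gamma>) \<Rightarrow> h \<in> \<O> \<and> \<gamma> \<in> C \<and> t \<otimes> x t' = x h \<otimes> \<gamma>"
    then obtain h' \<gamma> where p: "p = (h', \<gamma>)" "h' \<in> \<O>" "\<gamma> \<in> C" "t \<otimes> x t' = x h' \<otimes> \<gamma>"
      by (cases p) auto
    have \<gamma>: "\<gamma> \<in> carrier G" "conj_by G \<gamma> s = s"
      using p(3) by (auto dest: centralizer_dest)
    have "h' = conj_by G (x h' \<otimes> \<gamma>) s" using \<gamma> x_conj[OF p(2)] x_carrier[OF p(2)] s_carrier
      by (simp add: conj_by_mult)
    also have "\<dots> = ?h" unfolding p(4)[symmetric] using c x_conj[OF assms(2)]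
      by (simp add: conj_by_mult)
    finally have "h' = ?h" .
    moreover have "\<gamma> = inv (x h') \<otimes> (t \<otimes> x t')" unfolding p(4) using \<gamma> x_carrier[OF p(2)]
      by (simp add: m_assoc[symmetric])
    ultimately show "p = (?h, ?\<gamma>)" using c p(1) by (simp add: m_assoc)
  qed
  then show ?thesis
    by (simp add: yd_braiding_def Let_def vec_def sum_distrib_right single_mult_single)
qed

lemma braid_vec:
  assumes "t \<in> \<O>" "t' \<in> \<O>"
  shows "braid_at (yd_braiding G \<O> s x scale \<rho> B) 0 (vec t u * vec t' v) =
    vec (conj_by G t t') (\<rho> (inv (x (conj_by G t t')) \<otimes> t \<otimes> x t') v) * vec t u"
proof -
  let ?h = "conj_by G t t'"
  let ?\<gamma> = "inv (x ?h) \<otimes> t \<otimes> x t'"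
  let ?c = "yd_braiding G \<O> s x scale \<rho> B"
  interpret R: Vector_Spaces.linear scale scale "\<rho> ?\<gamma>"
    using rho_linear stabilizing_part class_carrier assms by blast
  have sum: "braid_at ?c 0 (\<Sum>i\<in>I. f i) = (\<Sum>i\<in>I. braid_at ?c 0 (f i))" for I :: "'i set" and f
    by (induction I rule: infinite_finite_induct) (auto simp: braid_at_linear)
  have key: "tscale (a * d) (p * single w 1) = tscale d p * single w a"
    for a d and w :: "('a \<times> 'v) list" and p
  proof -
    have "single w a = tscale a (single w 1)" by simp
    then show ?thesis
      by (simp only: tscale_mult_left tscale_mult_right tscale_simps(4) mult.commute)
  qed
  have "braid_at ?c 0 (vec t u * vec t' v) = (\<Sum>b | coord u b \<noteq> 0. \<Sum>b' | coord v b' \<noteq> 0.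
      tscale (coord u b * coord v b') (vec ?h (\<rho> ?\<gamma> b') * single [(t, b)] 1))"
    unfolding vec_def[of t u] vec_def[of t' v] sum_product sum
    using assms by (simp add: single_mult_single braid_at_single yd_braiding_basis single_Nil_1)
  also have "\<dots> = (\<Sum>b' | coord v b' \<noteq> 0. \<Sum>b | coord u b \<noteq> 0.
      vec ?h (scale (coord v b') (\<rho> ?\<gamma> b')) * single [(t, b)] (coord u b))"
    by (subst sum.swap) (simp only: key vec_linear)
  also have "\<dots> = vec ?h (\<Sum>b' | coord v b' \<noteq> 0. scale (coord v b') (\<rho> ?\<gamma> b')) * vec t u"
    unfolding vec_sum vec_def[of t u] sum_product ..
  also have "(\<Sum>b' | coord v b' \<noteq> 0. scale (coord v b') (\<rho> ?\<gamma> b')) = \<rho> ?\<gamma> v"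
    by (subst (3) sum_coord[of v, symmetric]) (simp add: R.sum R.scale)
  finally show ?thesis .
qed

end

section \<open>Infinite dimension\<close>

lemma probe_letters: "length (probe n) = 4 * n" "set (probe n) \<subseteq> {1..6} \<times> UNIV"
  by (induction n) (auto simp: probe_def)

lemma primitive_cube_root:
  obtains \<omega> :: complex where "\<omega>\<^sup>2 + \<omega> + 1 = 0" "1 - \<omega> * \<omega> \<noteq> 0"
proof -
  define \<omega> where "\<omega> = Complex (- 1 / 2) (sqrt 3 / 2)"
  have 1: "\<omega>\<^sup>2 + \<omega> + 1 = 0"
    by (simp add: \<omega>_def complex_eq_iff power2_eq_square)
  have "1 - \<omega> * \<omega> = 2 + \<omega>" using 1 by (simp add: power2_eq_square algebra_simps eq_neg_iff_add_eq_0)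
  also have "\<dots> \<noteq> 0" by (simp add: \<omega>_def complex_eq_iff)
  finally show thesis using that 1 by blast
qed

text \<open>In each degree \<open>4 m\<close> the \<open>m\<close>-th power of the null root vector has a nonzero iterated
derivative.\<close>

theorem nichols_dim_double_octahedral:
  assumes "constant_rack_braiding ({1..6} \<times> UNIV) oct_op (-1) c vec E"
  shows "nichols_dim E c = \<infinity>"
proof (rule nichols_dim_infinite)
  fix m :: nat
  interpret constant_rack_braiding "{1..6} \<times> UNIV" oct_op "-1" c vec E by fact
  obtain \<omega> :: complex where \<omega>: "\<omega>\<^sup>2 + \<omega> + 1 = 0" "1 - \<omega> * \<omega> \<noteq> 0"
    by (rule primitive_cube_root)
  let ?p = "null_root \<omega> ^ m"
  have p: "?p \<in> tensor_power ({1..6} \<times> UNIV) (4 * m)" by (rule null_root_power_tensor_power)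
  have "quantum_symmetrizer c (4 * m) (embed ?p) \<noteq> 0"
  proof
    assume "quantum_symmetrizer c (4 * m) (embed ?p) = 0"
    then have "foldr (skew_derivation oct_op (-1)) (probe m) ?p = 0"
      using derivatives_vanish[OF p] probe_letters by blast
    then have "tscale (fact m * (1 - \<omega> * \<omega>) ^ (3 * m)) (1 :: (nat \<times> bool) tensor) = 0"
      using probe_null_root_power[OF \<omega>(1)] by simp
    then have "lookup (tscale (fact m * (1 - \<omega> * \<omega>) ^ (3 * m)) (1 :: (nat \<times> bool) tensor)) 0 = 0"
      by simp
    then show False using \<omega>(2) by (simp add: lookup_tscale)
  qed
  then show "\<exists>n\<ge>m. \<exists>p\<in>tensor_power E n. quantum_symmetrizer c n p \<noteq> 0"
    using embed_tensor_power[OF p] by (intro exI[of _ "4 * m"]) auto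
qed

text \<open>The words reach all indices from 1, simultaneously for every family on which the \<open>\<sigma>\<^sub>j\<close> act
through the rack; in the application these families are \<open>\<sigma>\<close> and \<open>\<tau>\<close>.\<close>

lemma (in group) oct_word_conj:
  assumes O: "type_O G \<sigma>" and \<mu>: "\<mu> ` {1..6} \<subseteq> carrier G"
    "\<And>i j. i \<in> {1..6} \<Longrightarrow> j \<in> {1..6} \<Longrightarrow> conj_by G (\<sigma> i) (\<mu> j) = \<mu> (oct_perm i j)"
    and i: "i \<in> {1..6}"
  shows "conj_by G (oct_word G \<sigma> i) (\<mu> 1) = \<mu> i"
proof -
  have c: "\<sigma> 2 \<in> carrier G" "\<mu> 1 \<in> carrier G" using \<mu> type_O_carrier[OF O] by auto
  then have "conj_by G (\<sigma> 2 \<otimes> \<sigma> 2) (\<mu> 1) = conj_by G (\<sigma> 2) (conj_by G (\<sigma> 2) (\<mu> 1))"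
    by (simp add: conj_by_def m_assoc inv_mult_group)
  moreover have "conj_by G \<one> (\<mu> 1) = \<mu> 1" using c by (simp add: conj_by_def)
  ultimately show ?thesis
    using i \<mu>(2)[of 2 1] \<mu>(2)[of 2 3] \<mu>(2)[of 3 1] \<mu>(2)[of 4 1] \<mu>(2)[of 5 1] unfolding six_cases
    by (elim disjE) (simp_all add: oct_word_def oct_perm_table del: One_nat_def)
qed

lemma oct_sign_0_iff: "oct_sign i v = 0 \<longleftrightarrow> v = 0"
  by (simp add: oct_sign_def)

text \<open>The twelve vectors are obtained by applying the six words to \<open>1 \<otimes> v\<close> and to \<open>g \<otimes> w\<close>, which
have degrees \<open>\<sigma>\<^sub>1\<close> and \<open>\<tau>\<^sub>1\<close>. The hypotheses say exactly that \<open>\<sigma>\<^sub>1\<close>, \<open>\<sigma>\<^sub>6\<close> and \<open>\<tau>\<^sub>1\<close> act by \<open>-1\<close>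
on both.\<close>

theorem theorem4p11:
  fixes G :: "('g, 'm) monoid_scheme" (structure)
    and \<sigma> \<tau> :: "nat \<Rightarrow> 'g"
    and \<O> :: "'g set"
    and g :: 'g
    and scale :: "complex \<Rightarrow> 'v::ab_group_add \<Rightarrow> 'v"
    and \<rho> :: "'g \<Rightarrow> 'v \<Rightarrow> 'v"
    and x :: "'g \<Rightarrow> 'g"
    and B :: "'v set"
  assumes "group G" and "finite (carrier G)"
    and "\<O> \<in> conjugacy_classes G"
    and "irreducible_representation_of (G\<lparr>carrier := centralizer G (\<sigma> 1)\<rparr>) scale \<rho>"
    and H1: "type_O2 G \<sigma> \<tau>"
    and H2: "\<sigma> ` {1..6} \<subseteq> \<O>" "\<tau> ` {1..6} \<subseteq> \<O>" "g \<in> carrier G" "g \<otimes> \<sigma> 1 \<otimes> inv g = \<tau> 1"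
    and H3: "scalar_of scale (\<rho> (\<sigma> 1)) = -1"
    and H4_H5: "\<exists>v. v \<noteq> 0 \<and> \<rho> (\<sigma> 6) v = - v \<and> \<rho> (\<tau> 1) v = - v"
    and H6_H7: "\<exists>w. w \<noteq> 0 \<and> \<rho> (inv g \<otimes> \<sigma> 1 \<otimes> g) w = - w \<and> \<rho> (inv g \<otimes> \<sigma> 6 \<otimes> g) w = - w"
    and representatives: "class_representatives G \<O> (\<sigma> 1) x"
    and basis: "\<not> module.dependent scale B" "module.span scale B = UNIV"
  shows "nichols_dim (\<O> \<times> B) (yd_braiding G \<O> (\<sigma> 1) x scale \<rho> B) = \<infinity>"
proof -
  \<comment> \<open>The index 1 is a label here and must not be rewritten to a successor.\<close>
  note One_nat_def [simp del]
  interpret group G by fact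
  interpret yetter_drinfeld_data G \<O> "\<sigma> 1" scale \<rho> x B
  proof
    show "\<sigma> 1 \<in> \<O>" using H2(1) by auto
    show "representation_of (G\<lparr>carrier := centralizer G (\<sigma> 1)\<rparr>) scale \<rho>"
      using assms(4) by (simp add: irreducible_representation_of_def)
  qed (fact assms(3) representatives basis)+
  have O: "type_O G \<sigma>" "type_O G \<tau>" and disj: "\<sigma> ` {1..6} \<inter> \<tau> ` {1..6} = {}"
    and conj: "\<And>i j. i \<in> {1..6} \<Longrightarrow> j \<in> {1..6} \<Longrightarrow> conj_by G (\<sigma> i) (\<tau> j) = \<tau> (oct_perm i j)"
      "\<And>i j. i \<in> {1..6} \<Longrightarrow> j \<in> {1..6} \<Longrightarrow> conj_by G (\<tau> i) (\<sigma> j) = \<sigma> (oct_perm i j)"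
      "\<And>i j. i \<in> {1..6} \<Longrightarrow> j \<in> {1..6} \<Longrightarrow> conj_by G (\<sigma> i) (\<sigma> j) = \<sigma> (oct_perm i j)"
      "\<And>i j. i \<in> {1..6} \<Longrightarrow> j \<in> {1..6} \<Longrightarrow> conj_by G (\<tau> i) (\<tau> j) = \<tau> (oct_perm i j)"
    using H1 by (auto simp: type_O2_def type_O_def)
  note cs = type_O_carrier[OF O(1)] and ct = type_O_carrier[OF O(2)]
  have I: "(1::nat) \<in> {1..6}" "(6::nat) \<in> {1..6}" by auto
  note c16 = cs[OF I(1)] cs[OF I(2)] ct[OF I(1)] \<open>g \<in> carrier G\<close>
  have g: "conj_by G g (\<sigma> 1) = \<tau> 1" using H2(4) by (simp add: conj_by_def)
  obtain v where v: "v \<noteq> 0" "\<rho> (\<sigma> 6) v = - v" "\<rho> (\<tau> 1) v = - v" using H4_H5 by blast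
  obtain w where w: "w \<noteq> 0" "\<rho> (inv g \<otimes> \<sigma> 1 \<otimes> g) w = - w" "\<rho> (inv g \<otimes> \<sigma> 6 \<otimes> g) w = - w"
    using H6_H7 by blast
  have \<rho>1: "\<rho> (\<sigma> 1) u = - u" for u
    using central_acts_by_scalar[OF assms(1,2) c16(1) assms(4), of u] H3 by simp
  have C: "\<sigma> 1 \<in> C" "\<sigma> 6 \<in> C" "\<tau> 1 \<in> C"
    using conj c16 I by (simp_all add: centralizer_iff oct_perm_table del: One_nat_def)
  have Cg: "inv g \<otimes> h \<otimes> g \<in> C" if h: "h \<in> carrier G" "conj_by G h (\<tau> 1) = \<tau> 1" for h
  proof -
    have "conj_by G (inv g \<otimes> h \<otimes> g) (\<sigma> 1) = conj_by G (inv g) (conj_by G g (\<sigma> 1))"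
      using h c16 by (simp add: conj_by_mult g del: One_nat_def)
    also have "\<dots> = \<sigma> 1"
      using c16 by (simp add: conj_by_mult[symmetric] del: One_nat_def) (simp add: conj_by_def)
    finally show ?thesis using h c16 by (simp add: centralizer_iff)
  qed
  have translate_minus: "translate k (- u) = - translate k u" if "k \<in> carrier G" for k u
  proof -
    interpret T: Vector_Spaces.linear scale scale "translate k" by (rule translate_linear[OF that])
    show ?thesis by (rule T.neg)
  qed
  \<comment> \<open>The vectors \<open>k \<otimes> v\<close> and \<open>k g \<otimes> w\<close>.\<close>
  define f where "f b k = (if b then translate (k \<otimes> g) w else translate k v)" for b :: bool and k
  have f1: "f b (k \<otimes> \<sigma> 1) = - f b k" and f6: "f b (k \<otimes> \<sigma> 6) = - f b k"
    and ft: "f b (k \<otimes> \<tau> 1) = - f b k" if k: "k \<in> carrier G" for b k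
  proof -
    have swap: "translate (k \<otimes> h \<otimes> g) w = translate (k \<otimes> g) (\<rho> (inv g \<otimes> h \<otimes> g) w)"
      if "h \<in> carrier G" "conj_by G h (\<tau> 1) = \<tau> 1" for h
    proof -
      have "k \<otimes> h \<otimes> g = k \<otimes> g \<otimes> (inv g \<otimes> h \<otimes> g)"
        using that k c16 by (simp add: m_assoc) (simp add: m_assoc[symmetric])
      then show ?thesis using translate_mult_C[OF _ Cg[OF that], of "k \<otimes> g" w] k c16 by simp
    qed
    have "inv g \<otimes> \<tau> 1 \<otimes> g = \<sigma> 1"
      using c16 unfolding H2(4)[symmetric] by (simp add: m_assoc) (simp add: m_assoc[symmetric])
    then have wt: "\<rho> (inv g \<otimes> \<tau> 1 \<otimes> g) w = - w" using \<rho>1 by simp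
    have fixes_\<tau>: "conj_by G h (\<tau> 1) = \<tau> 1" if "h \<in> {\<sigma> 1, \<sigma> 6, \<tau> 1}" for h
      using that conj I by (auto simp: oct_perm_table simp del: One_nat_def)
    show "f b (k \<otimes> \<sigma> 1) = - f b k" "f b (k \<otimes> \<sigma> 6) = - f b k" "f b (k \<otimes> \<tau> 1) = - f b k"
      using k c16 fixes_\<tau>
      by (simp_all add: f_def swap translate_mult_C C \<rho>1 v w wt translate_minus del: One_nat_def)
  qed
  define base where "base b = (if b then g else \<one>)" for b :: bool
  define word where "word a = oct_word G \<sigma> (fst a) \<otimes> base (snd a)" for a :: "nat \<times> bool"
  define t where "t a = (if snd a then \<tau> (fst a) else \<sigma> (fst a))" for a :: "nat \<times> bool"
  define val where "val a = oct_sign (fst a) (f (snd a) (oct_word G \<sigma> (fst a)))"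
    for a :: "nat \<times> bool"
  have word_c: "oct_word G \<sigma> i \<in> carrier G" for i using cs by (simp add: oct_word_def)
  have base_c: "base b \<in> carrier G" for b using c16 by (simp add: base_def)
  have f_translate: "f b k = translate (k \<otimes> base b) (if b then w else v)" if "k \<in> carrier G" for b k
    using that by (simp add: f_def base_def)
  have tO: "t a \<in> \<O>" if "a \<in> {1..6} \<times> UNIV" for a
    using that H2(1,2) by (auto simp: t_def)
  have inj: "inj_on \<sigma> {1..6}" "inj_on \<tau> {1..6}" using O by (auto simp: type_O_def)
  have ne: "\<sigma> i \<noteq> \<tau> j" if "i \<in> {1..6}" "j \<in> {1..6}" for i j
    using disj that by blast
  have t_inj: "a = b" if "a \<in> {1..6} \<times> UNIV" "b \<in> {1..6} \<times> UNIV" "t a = t b" for a b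
  proof -
    have "fst a \<in> {1..6}" "fst b \<in> {1..6}" using that by auto
    then show ?thesis
      using that(3) ne[of "fst a" "fst b"] ne[of "fst b" "fst a"] inj unfolding t_def
      by (cases "snd a"; cases "snd b") (auto simp: prod_eq_iff inj_on_eq_iff)
  qed
  have t_conj: "conj_by G (t a) (t b) = t (oct_op a b)"
    if "a \<in> {1..6} \<times> UNIV" "b \<in> {1..6} \<times> UNIV" for a b
    using that conj by (auto simp: t_def oct_op_def)
  have t_word: "conj_by G (word a) (\<sigma> 1) = t a" if "a \<in> {1..6} \<times> UNIV" for a
  proof -
    have "conj_by G (word a) (\<sigma> 1) = conj_by G (oct_word G \<sigma> (fst a)) (conj_by G (base (snd a)) (\<sigma> 1))"
      using word_c base_c c16 by (simp add: word_def conj_by_mult del: One_nat_def)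
    also have "conj_by G (base (snd a)) (\<sigma> 1) = (if snd a then \<tau> 1 else \<sigma> 1)"
      using g c16 by (simp add: base_def conj_by_def)
    also have "conj_by G (oct_word G \<sigma> (fst a)) \<dots> = t a"
      using that oct_word_conj[OF O(1), of \<sigma> "fst a"] oct_word_conj[OF O(1), of \<tau> "fst a"] conj cs ct
      by (auto simp: t_def image_subset_iff)
    finally show ?thesis .
  qed
  have val_ne: "val a \<noteq> 0" for a
    using translate_eq_0[of "word a" w] translate_eq_0[of "word a" v] word_c base_c v(1) w(1)
    by (auto simp: word_def val_def oct_sign_0_iff f_translate split: if_splits)
  have val_act: "\<rho> (inv (x (t (oct_op a b))) \<otimes> t a \<otimes> x (t b)) (val b) = - val (oct_op a b)"
    if a: "a \<in> {1..6} \<times> UNIV" and b: "b \<in> {1..6} \<times> UNIV" for a b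
  proof -
    let ?k = "inv (x (t (oct_op a b))) \<otimes> t a \<otimes> x (t b)"
    let ?W = "oct_word G \<sigma> (fst b)" and ?u = "if snd b then w else v"
    have ta: "t a \<in> carrier G" using class_carrier[OF tO[OF a]] .
    have k: "?k \<in> C" using stabilizing_part[OF ta tO[OF b]] t_conj[OF a b] by simp
    interpret K: Vector_Spaces.linear scale scale "\<rho> ?k" by (rule rho_linear[OF k])
    have "\<rho> ?k (translate (word b) ?u) = translate (t a \<otimes> word b) ?u"
      using translate_translate[OF ta, of "word b" ?u] t_word[OF b] t_conj[OF a b] word_c base_c
      by (simp add: word_def)
    also have "\<dots> = f (snd b) (t a \<otimes> ?W)"
      using ta word_c base_c by (simp add: f_translate word_def m_assoc)
    finally have "\<rho> ?k (f (snd b) ?W) = f (snd b) (t a \<otimes> ?W)"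
      using word_c by (simp add: f_translate word_def)
    then have "\<rho> ?k (val b) = oct_sign (fst b) (f (snd b) (t a \<otimes> ?W))"
      by (simp add: val_def oct_sign_def K.neg)
    also have "\<dots> = - val (oct_op a b)"
      using octahedral_double_orbit[OF H1, of "f (snd b)" "fst b" "fst a" "snd a"] f1 f6 ft a b
      by (auto simp: val_def t_def oct_op_def)
    finally show ?thesis .
  qed
  have op_closed: "oct_op a b \<in> {1..6} \<times> UNIV" if "b \<in> {1..6} \<times> UNIV" for a b
    using that oct_perm_closed[of "fst b" "fst a"]
      by (auto simp: oct_op_def simp del: atLeastAtMost_iff)
  have "constant_rack_braiding ({1..6} \<times> UNIV) oct_op (-1) (yd_braiding G \<O> (\<sigma> 1) x scale \<rho> B)
      (\<lambda>a. vec (t a) (val a)) (\<O> \<times> B)"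
  proof
    show "finite ({1..6::nat} \<times> (UNIV :: bool set))" by simp
    show "oct_op a (oct_op b d) = oct_op (oct_op a b) (oct_op a d)" for a b d
      by (simp add: oct_op_def oct_perm_self_distrib[of "fst a" "fst b" "fst d"])
    show "oct_op a b \<in> {1..6} \<times> UNIV" if "a \<in> {1..6} \<times> UNIV" "b \<in> {1..6} \<times> UNIV" for a b
      by (rule op_closed[OF that(2)])
  next
    fix a :: "nat \<times> bool" assume a: "a \<in> {1..6} \<times> UNIV"
    show "vec (t a) (val a) \<in> tensor_power (\<O> \<times> B) 1"
      using tO[OF a] coord_in_B
      by (auto simp: tensor_power_def in_keys_iff lookup_vec split: list.splits if_splits)
    obtain b where b: "coord (val a) b \<noteq> 0"
      using sum_coord[of "val a"] val_ne[of a]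
        by (metis (mono_tags, lifting) empty_Collect_eq sum.empty)
    show "\<exists>e. lookup (vec (t a) (val a)) [e] \<noteq> 0 \<and>
        (\<forall>b\<in>{1..6} \<times> UNIV - {a}. lookup (vec (t b) (val b)) [e] = 0)"
      using b t_inj[OF a] by (intro exI[of _ "(t a, b)"]) (auto simp: lookup_vec)
  next
    fix a b :: "nat \<times> bool" assume a: "a \<in> {1..6} \<times> UNIV" and b: "b \<in> {1..6} \<times> UNIV"
    have neg: "vec h (- u) = tscale (-1) (vec h u)" for h u
      using vec_linear(2)[of h "-1" u] by simp
    show "braid_at (yd_braiding G \<O> (\<sigma> 1) x scale \<rho> B) 0 (vec (t a) (val a) * vec (t b) (val b)) =
        tscale (- 1) (vec (t (oct_op a b)) (val (oct_op a b)) * vec (t a) (val a))"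
      unfolding braid_vec[OF tO[OF a] tO[OF b]] t_conj[OF a b] val_act[OF a b] neg by simp
  qed
  then show ?thesis by (rule nichols_dim_double_octahedral)
qed

end
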